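(* Let $d\in\mathbb{N}$, $d\ge 1$, $r,s\ge0$, $\alpha>2r+d$ and $\beta>2s+d$. Suppose that $g\in L^2(\mathbb{R}^d)$ satisfies $$\int_{\mathbb{R}^d}|g(x)|(1+|x|)^\alpha\,dx<\infty\quad\text{and}\quad\int_{\mathbb{R}^d}|\widehat g(\omega)|(1+|\omega|)^\beta\,d\omega<\infty .$$ Then $g\in\mathcal{A}_{v_{r,s}}$, i.e. $$\int_{\mathbb{R}^d}\int_{\mathbb{R}^d}|V_gg(x,\omega)|(1+|x|)^r(1+|\omega|)^s\,dx\,d\omega<\infty .$$
   Context: The Fourier transform is $\widehat f(\omega)=\int_{\mathbb{R}^d}f(x)e^{-2\pi i x\omega}\,dx$ (extended to $L^2$), where $x\omega$ is the dot product. For $f,g\in L^2(\mathbb{R}^d)$ the short-time Fourier transform is $V_gf(x,\omega)=\int_{\mathbb{R}^d}f(t)\overline{g(t-x)}e^{-2\pi i t\omega}\,dt$, $x,\omega\in\mathbb{R}^d$. For $r,s\ge0$, $v_{r,s}(x,\omega)=(1+|x|)^r(1+|\omega|)^s$, and $\mathcal{A}_{v_{r,s}}=\{g\in L^2(\mathbb{R}^d): V_gg\in L^1_{v_{r,s}}(\mathbb{R}^d\times\mathbb{R}^d)\}$, i.e. those $g$ for which $V_gg\cdot v_{r,s}$ is integrable on $\mathbb{R}^{2d}$. *)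

theory Defs
  imports "HOL-Analysis.Analysis"
begin

definition L2 :: "('a::euclidean_space \<Rightarrow> complex) set" where
  "L2 = {f. f \<in> borel_measurable lebesgue \<and> integrable lebesgue (\<lambda>x. (cmod (f x))\<^sup>2)}"

definition fourier_integral :: "('a::euclidean_space \<Rightarrow> complex) \<Rightarrow> 'a \<Rightarrow> complex" where
  "fourier_integral f \<omega> = (LINT x|lebesgue. f x * cis (- (2 * pi * (x \<bullet> \<omega>))))"

text \<open>
  The Fourier transform on \<open>L2\<close> extends the integral by continuity from integrable functions in
  \<open>L2\<close>. For \<open>f\<close> in \<open>L2\<close> the truncations of \<open>f\<close> to balls of radius \<open>n\<close> are such functions and
  converge to \<open>f\<close> in \<open>L2\<close>, so the transform of \<open>f\<close> is the limit in \<open>L2\<close> of their transforms.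
\<close>

definition is_fourier_L2 ::
    "('a::euclidean_space \<Rightarrow> complex) \<Rightarrow> ('a \<Rightarrow> complex) \<Rightarrow> bool" where
  "is_fourier_L2 f h \<longleftrightarrow> h \<in> L2 \<and>
     (\<lambda>n::nat. \<integral>\<^sup>+\<omega>. ennreal ((cmod (fourier_integral
          (\<lambda>x. indicator (cball 0 (real n)) x * f x) \<omega> - h \<omega>))\<^sup>2) \<partial>lebesgue) \<longlonglongrightarrow> 0"

text \<open>
  The limit exists for every \<open>f\<close> in \<open>L2\<close> by Plancherel's theorem and is unique up to null sets;
  the choice operator picks a representative.
\<close>

definition fourier_L2 :: "('a::euclidean_space \<Rightarrow> complex) \<Rightarrow> 'a \<Rightarrow> complex" where
  "fourier_L2 f = (SOME h. is_fourier_L2 f h)"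

text \<open>The window is the first argument: \<open>stft g f\<close> is $V_g f$.\<close>

definition stft ::
    "('a::euclidean_space \<Rightarrow> complex) \<Rightarrow> ('a \<Rightarrow> complex) \<Rightarrow> 'a \<times> 'a \<Rightarrow> complex" where
  "stft g f = (\<lambda>(x, \<omega>). LINT t|lebesgue. f t * cnj (g (t - x)) * cis (- (2 * pi * (t \<bullet> \<omega>))))"

definition weight :: "real \<Rightarrow> real \<Rightarrow> 'a::euclidean_space \<times> 'a \<Rightarrow> real" where
  "weight r s = (\<lambda>(x, \<omega>). (1 + norm x) powr r * (1 + norm \<omega>) powr s)"

definition window_class ::
    "('a::euclidean_space \<times> 'a \<Rightarrow> real) \<Rightarrow> ('a \<Rightarrow> complex) set" where
  "window_class v = {g \<in> L2. integrable lebesgue (\<lambda>z. stft g g z * of_real (v z))}"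

end

theory Submission
  imports Defs "HOL-Probability.Characteristic_Functions"
begin

text \<open>
  Write \<open>G\<close> for the Fourier transform of \<open>g\<close>. Directly, \<open>|V_g g (x, \<omega>)| \<le> A x\<close> with
  \<open>A x = \<integral> |g t| |g (t - x)| dt\<close>; since \<open>g\<close> and \<open>G\<close> are integrable, Fourier inversion also gives
  \<open>|V_g g (x, \<omega>)| \<le> B \<omega>\<close> with \<open>B \<omega> = \<integral> |G \<eta>| |G (\<eta> - \<omega>)| d\<eta>\<close>. Hence
  \<open>|V_g g (x, \<omega>)| \<le> sqrt (A x) sqrt (B \<omega>)\<close>, and the variables separate. As the weight
  \<open>w x = 1 + |x|\<close> is submultiplicative, \<open>A w\<^sup>\<alpha>\<close> is integrable, and
  \<open>sqrt A w\<^sup>r \<le> A w\<^sup>\<alpha> + w powr (2 r - \<alpha>)\<close>, where the last term is integrable because \<open>\<alpha> > 2 r + d\<close>.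
  The same argument applies to \<open>B\<close>.

  The inversion theorem and the Plancherel inequality, which identifies the \<open>L2\<close> transform of \<open>g\<close>
  with its Fourier integral, come from regularizing with Gaussians.
\<close>

subsection \<open>Lebesgue measure on Euclidean space and Gaussians\<close>

lemma nn_integral_lborel_affine:
  fixes f :: "'a::euclidean_space \<Rightarrow> ennreal" and t :: 'a
  assumes [measurable]: "f \<in> borel_measurable borel" and c: "c \<noteq> 0"
  shows "(\<integral>\<^sup>+x. f x \<partial>lborel) = ennreal (\<bar>c\<bar> ^ DIM('a)) * (\<integral>\<^sup>+x. f (t + c *\<^sub>R x) \<partial>lborel)"
  by (subst lborel_affine[OF c, of t])
     (simp add: nn_integral_density nn_integral_distr nn_integral_cmult)

lemma integrable_lborel_affine:
  fixes f :: "'a::euclidean_space \<Rightarrow> 'b::{banach, second_countable_topology}" and t :: 'a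
  assumes f: "integrable lborel f" and c: "c \<noteq> 0"
  shows "integrable lborel (\<lambda>x. f (t + c *\<^sub>R x))"
proof -
  have [measurable]: "f \<in> borel_measurable borel"
    using f by auto
  have "(\<integral>\<^sup>+x. norm (f x) \<partial>lborel) < \<infinity>"
    using f by (simp add: integrable_iff_bounded)
  then have "(\<integral>\<^sup>+x. norm (f (t + c *\<^sub>R x)) \<partial>lborel) < \<infinity>"
    by (subst (asm) nn_integral_lborel_affine[OF _ c, where t=t])
       (use c in \<open>auto simp: ennreal_mult_less_top\<close>)
  then show ?thesis
    by (simp add: integrable_iff_bounded)
qed

lemma integrable_lborel_affine_iff:
  fixes f :: "'a::euclidean_space \<Rightarrow> 'b::{banach, second_countable_topology}" and t :: 'a
  assumes c: "c \<noteq> 0"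
  shows "integrable lborel (\<lambda>x. f (t + c *\<^sub>R x)) \<longleftrightarrow> integrable lborel f"
proof
  assume "integrable lborel (\<lambda>x. f (t + c *\<^sub>R x))"
  from integrable_lborel_affine[OF this, where c="inverse c" and t="- (inverse c *\<^sub>R t)"] c
  show "integrable lborel f"
    by (simp add: algebra_simps)
qed (rule integrable_lborel_affine[OF _ c])

lemma integral_lborel_affine:
  fixes f :: "'a::euclidean_space \<Rightarrow> 'b::{banach, second_countable_topology}" and t :: 'a
  assumes c: "c \<noteq> 0"
  shows "(LINT x|lborel. f x) = \<bar>c\<bar> ^ DIM('a) *\<^sub>R (LINT x|lborel. f (t + c *\<^sub>R x))"
proof (cases "integrable lborel f")
  case True
  then have [measurable]: "f \<in> borel_measurable borel"
    by auto
  have "integrable lborel (\<lambda>x. f (t + c *\<^sub>R x))"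
    by (rule integrable_lborel_affine[OF True c])
  then show ?thesis
    by (subst lborel_affine[OF c, of t]) (simp add: integral_density integral_distr)
\<comment> \<open>If \<open>f\<close> is not integrable, neither is its affine image, and both
  Bochner integrals take the default value 0.\<close>
next
  case False
  then show ?thesis
    by (simp add: not_integrable_integral_eq integrable_lborel_affine_iff[OF c])
qed

lemma integral_lborel_translate:
  fixes f :: "'a::euclidean_space \<Rightarrow> 'b::{banach, second_countable_topology}"
  shows "(LINT x|lborel. f (x - t)) = (LINT x|lborel. f x)"
  using integral_lborel_affine[of 1 f "- t"] by simp

lemma nn_integral_lborel_reflect:
  fixes f :: "'a::euclidean_space \<Rightarrow> ennreal"
  assumes "f \<in> borel_measurable borel"
  shows "(\<integral>\<^sup>+x. f (t - x) \<partial>lborel) = (\<integral>\<^sup>+x. f x \<partial>lborel)"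
  using nn_integral_lborel_affine[OF assms, of "- 1" t] by simp

text \<open>Lebesgue measure is the image of the product measure over \<open>Basis\<close> under the
  map that assembles a vector from its coordinates, so products of functions of one coordinate
  integrate factor by factor. This reduces Gaussians and polynomial weights to dimension
  one.\<close>

lemma has_bochner_integral_lborel_prod:
  fixes f :: "'a::euclidean_space \<Rightarrow> real \<Rightarrow> 'b::{real_normed_field, banach, second_countable_topology}"
  assumes f: "\<And>b. b \<in> Basis \<Longrightarrow> integrable lborel (f b)"
  shows "has_bochner_integral lborel (\<lambda>x. \<Prod>b\<in>Basis. f b (x \<bullet> b))
           (\<Prod>b\<in>Basis. LINT x|lborel. f b x)"
proof -
  interpret product_sigma_finite "\<lambda>_::'a. lborel :: real measure"
    by standard
  let ?P = "\<Pi>\<^sub>M b\<in>(Basis :: 'a set). (lborel :: real measure)"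
  let ?T = "\<lambda>x. \<Sum>b\<in>(Basis :: 'a set). x b *\<^sub>R b"
  let ?F = "\<lambda>x. \<Prod>b\<in>Basis. f b (x \<bullet> b)"
  have [measurable]: "f b \<in> borel_measurable borel" if "b \<in> Basis" for b
    using f[OF that] by auto
  have [measurable]: "?T \<in> ?P \<rightarrow>\<^sub>M borel"
    by measurable
  have F [measurable]: "?F \<in> borel_measurable borel"
    by measurable
  have eq: "?F (?T x) = (\<Prod>b\<in>Basis. f b (x b))" for x
    by (intro prod.cong) auto
  have "integrable ?P (\<lambda>x. ?F (?T x))"
    unfolding eq by (intro product_integrable_prod f) auto
  then have "integrable (distr ?P borel ?T) ?F"
    by (subst integrable_distr_eq) auto
  moreover have "(LINT x|distr ?P borel ?T. ?F x) = (\<Prod>b\<in>Basis. LINT x|lborel. f b x)"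
    by (subst integral_distr) (auto simp: eq intro!: product_integral_prod f)
  ultimately show ?thesis
    unfolding has_bochner_integral_iff lborel_eq[symmetric] by simp
qed

section \<open>Integrability of negative powers of the weight\<close>

lemma integrable_one_plus_abs_powr:
  fixes p :: real
  assumes p: "p > 1"
  shows "integrable lborel (\<lambda>x::real. (1 + \<bar>x\<bar>) powr - p)"
proof -
  let ?f = "\<lambda>x::real. (1 + x) powr - p"
  \<comment> \<open>An antiderivative of \<open>?f\<close> on the half line that vanishes at
    infinity, because \<open>p > 1\<close>.\<close>
  let ?F = "\<lambda>x::real. - ((1 + x) powr (1 - p) / (p - 1))"
  have lim: "(?F \<longlongrightarrow> 0) at_top"
  proof -
    have "filterlim (\<lambda>x::real. 1 + x) at_top at_top"
      by (intro filterlim_tendsto_add_at_top[OF tendsto_const] filterlim_ident)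
    then have "((\<lambda>x::real. (1 + x) powr (1 - p)) \<longlongrightarrow> 0) at_top"
      using p by (intro tendsto_neg_powr) auto
    then have "((\<lambda>x::real. - ((1 + x) powr (1 - p) / (p - 1))) \<longlongrightarrow> - (0 / (p - 1))) at_top"
      using p by (intro tendsto_intros) auto
    then show ?thesis
      by simp
  qed
  have half: "(\<integral>\<^sup>+x. ennreal (?f x) * indicator {0 ..} x \<partial>lborel) = ennreal (0 - ?F 0)"
  proof (rule nn_integral_FTC_atLeast[OF _ _ _ lim])
    fix x :: real assume "0 \<le> x"
    show "DERIV ?F x :> ?f x"
    proof -
      have "- ((1 - p) * u / (p - 1)) = u" for u :: real
        using p by (simp add: divide_simps) (simp add: algebra_simps)
      then show ?thesis
        using p \<open>0 \<le> x\<close> by (auto intro!: derivative_eq_intros DERIV_chain2[where g="\<lambda>x. 1 + x",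
          OF has_real_derivative_powr[where r="1 - p"]])
    qed
  qed auto
  have int: "integrable lborel (\<lambda>x::real. indicator {0 ..} x * ?f x)"
  proof -
    have "(\<integral>\<^sup>+x. norm (indicator {0 ..} x * ?f x) \<partial>lborel)
          = (\<integral>\<^sup>+x. ennreal (?f x) * indicator {0 ..} x \<partial>lborel)"
      by (intro nn_integral_cong) (auto simp: indicator_def)
    then show ?thesis
      unfolding integrable_iff_bounded half by simp
  qed
  have "integrable lborel (\<lambda>x::real. indicator {0 ..} (0 + (-1) *\<^sub>R x) * ?f (0 + (-1) *\<^sub>R x))"
    by (rule integrable_lborel_affine[OF int]) simp
  with int have "integrable lborel
      (\<lambda>x::real. indicator {0 ..} x * ?f x + indicator {0 ..} (0 + (-1) *\<^sub>R x) * ?f (0 + (-1) *\<^sub>R x))"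
    by (rule Bochner_Integration.integrable_add)
  \<comment> \<open>Both half lines contain 0, where the sum counts the integrand twice; hence
    domination instead of equality.\<close>
  then show ?thesis
    by (rule Bochner_Integration.integrable_bound) (auto simp: indicator_def)
qed

text \<open>Distribute the exponent evenly over the d coordinates: each coordinate is at most the
  norm in absolute value, so the function is dominated by a product of one-dimensional functions
  with exponent \<open>\<gamma> / d\<close>, which exceeds 1. No polar coordinates enter.\<close>

lemma integrable_one_plus_norm_powr:
  fixes \<gamma> :: real
  assumes \<gamma>: "\<gamma> > real DIM('a::euclidean_space)"
  shows "integrable lborel (\<lambda>x::'a. (1 + norm x) powr - \<gamma>)"
proof -
  let ?p = "\<gamma> / DIM('a)"
  have p: "?p > 1"
    using \<gamma> by (simp add: field_simps)
  have "integrable lborel (\<lambda>x::'a. \<Prod>b\<in>Basis. (1 + \<bar>x \<bullet> b\<bar>) powr - ?p)"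
    using has_bochner_integral_lborel_prod[where f="\<lambda>_::'a. \<lambda>x. (1 + \<bar>x\<bar>) powr - ?p"]
      integrable_one_plus_abs_powr[OF p] by (auto simp: has_bochner_integral_iff)
  then show ?thesis
  proof (rule Bochner_Integration.integrable_bound)
    have "(1 + norm x) powr - \<gamma> \<le> (\<Prod>b\<in>Basis. (1 + \<bar>x \<bullet> b\<bar>) powr - ?p)" for x :: 'a
    proof -
      have "(1 + norm x) powr - \<gamma> = (\<Prod>b\<in>(Basis::'a set). (1 + norm x) powr - ?p)"
        using add_pos_nonneg[OF zero_less_one norm_ge_zero, of x] by (simp add: powr_power)
      also have "\<dots> \<le> (\<Prod>b\<in>Basis. (1 + \<bar>x \<bullet> b\<bar>) powr - ?p)"
        using p by (intro prod_mono conjI powr_mono2') (auto simp: Basis_le_norm intro: add_pos_nonneg)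
      finally show ?thesis .
    qed
    then show "AE x::'a in lborel. norm ((1 + norm x) powr - \<gamma>)
        \<le> norm (\<Prod>b\<in>Basis. (1 + \<bar>x \<bullet> b\<bar>) powr - ?p)"
      by (intro AE_I2) (simp add: prod_nonneg)
  qed auto
qed

section \<open>Fourier integrals of Gaussians\<close>

lemma borel_measurable_cis [measurable]: "cis \<in> borel_measurable borel"
  by (intro borel_measurable_continuous_onI continuous_intros)

text \<open>This is the characteristic function of the standard normal distribution with the factor
  \<open>1 / sqrt (2 * pi)\<close> of its density moved to the other side.\<close>

lemma std_gaussian_integral_cis:
  "has_bochner_integral lborel (\<lambda>x::real. complex_of_real (exp (- x\<^sup>2 / 2)) * cis (t * x))
     (complex_of_real (sqrt (2 * pi) * exp (- t\<^sup>2 / 2)))"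
proof -
  have "integrable lborel (\<lambda>x. sqrt (2 * pi) * std_normal_density x)"
    by (intro integrable_mult_right) simp
  then have 1: "integrable lborel (\<lambda>x. complex_of_real (exp (- x\<^sup>2 / 2)) * cis (t * x))"
    by (rule Bochner_Integration.integrable_bound)
       (auto simp: norm_mult std_normal_density_def)
  have "complex_of_real (exp (- t\<^sup>2 / 2)) = char std_normal_distribution t"
    by (simp add: char_std_normal_distribution)
  also have "\<dots> = (LINT x|lborel. std_normal_density x *\<^sub>R iexp (t * x))"
    unfolding char_def by (subst integral_density) auto
  also have "\<dots> = (LINT x|lborel. complex_of_real (1 / sqrt (2 * pi)) *
        (complex_of_real (exp (- x\<^sup>2 / 2)) * cis (t * x)))"
    by (intro Bochner_Integration.integral_cong)
       (auto simp: std_normal_density_def cis_conv_exp scaleR_conv_of_real)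
  also have "\<dots> = complex_of_real (1 / sqrt (2 * pi)) *
      (LINT x|lborel. complex_of_real (exp (- x\<^sup>2 / 2)) * cis (t * x))"
    by (rule integral_mult_right_zero)
  finally have "complex_of_real (sqrt (2 * pi)) * complex_of_real (exp (- t\<^sup>2 / 2)) =
     complex_of_real (sqrt (2 * pi)) * complex_of_real (1 / sqrt (2 * pi)) *
      (LINT x|lborel. complex_of_real (exp (- x\<^sup>2 / 2)) * cis (t * x))"
    by simp
  then have "(LINT x|lborel. complex_of_real (exp (- x\<^sup>2 / 2)) * cis (t * x)) =
     complex_of_real (sqrt (2 * pi) * exp (- t\<^sup>2 / 2))"
    by (simp flip: of_real_mult)
  with 1 show ?thesis
    by (simp add: has_bochner_integral_iff)
qed

text \<open>Both the Gaussian and the character factor over the coordinates, and in each coordinate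
  the substitution of \<open>a * x\<close> for \<open>x\<close> leads to the standard
  Gaussian.\<close>

lemma gaussian_integral_cis:
  fixes y :: "'a::euclidean_space"
  assumes a: "a > 0"
  shows "has_bochner_integral lborel
     (\<lambda>x. complex_of_real (exp (- (a * norm x)\<^sup>2 / 2)) * cis (x \<bullet> y))
     (complex_of_real ((sqrt (2 * pi) / a) ^ DIM('a) * exp (- (norm y / a)\<^sup>2 / 2)))"
proof -
  let ?f = "\<lambda>b x. complex_of_real (exp (- (a * x)\<^sup>2 / 2)) * cis ((y \<bullet> b) * x)"
  have f: "has_bochner_integral lborel (?f b)
      (complex_of_real (sqrt (2 * pi) / a * exp (- ((y \<bullet> b) / a)\<^sup>2 / 2)))" for b
  proof -
    have "has_bochner_integral lborel
        (\<lambda>x. complex_of_real (exp (- (0 + a * x)\<^sup>2 / 2)) * cis ((y \<bullet> b) / a * (0 + a * x)))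
        (complex_of_real (sqrt (2 * pi) * exp (- ((y \<bullet> b) / a)\<^sup>2 / 2)) /\<^sub>R \<bar>a\<bar>)"
      using a std_gaussian_integral_cis[of "(y \<bullet> b) / a"]
        lborel_has_bochner_integral_real_affine_iff[of a
          "\<lambda>x. complex_of_real (exp (- x\<^sup>2 / 2)) * cis ((y \<bullet> b) / a * x)" _ 0] by blast
    then show ?thesis
      using a by (simp add: scaleR_conv_of_real field_simps)
  qed
  have "has_bochner_integral lborel (\<lambda>x. \<Prod>b\<in>Basis. ?f b (x \<bullet> b))
           (\<Prod>b\<in>Basis. LINT x|lborel. ?f b x)"
    using f by (intro has_bochner_integral_lborel_prod) (auto simp: has_bochner_integral_iff)
  moreover have "(\<Prod>b\<in>Basis. ?f b (x \<bullet> b)) =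
      complex_of_real (exp (- (a * norm x)\<^sup>2 / 2)) * cis (x \<bullet> y)" for x
  proof -
    have "(\<Prod>b\<in>Basis. ?f b (x \<bullet> b)) =
      complex_of_real (exp (\<Sum>b\<in>Basis. - (a * (x \<bullet> b))\<^sup>2 / 2)) * cis (\<Sum>b\<in>Basis. (y \<bullet> b) * (x \<bullet> b))"
      by (simp add: prod.distrib exp_sum cis_conv_exp sum_distrib_left)
    also have "(\<Sum>b\<in>Basis. - (a * (x \<bullet> b))\<^sup>2 / 2) = - (a * norm x)\<^sup>2 / 2"
      unfolding power_mult_distrib power2_norm_eq_inner euclidean_inner[of x x]
      by (simp add: sum_distrib_left sum_divide_distrib sum_negf power2_eq_square)
    also have "(\<Sum>b\<in>Basis. (y \<bullet> b) * (x \<bullet> b)) = x \<bullet> y"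
      by (simp add: euclidean_inner[of x y] mult.commute)
    finally show ?thesis .
  qed
  moreover have "(\<Prod>b\<in>Basis. LINT x|lborel. ?f b x) =
     complex_of_real ((sqrt (2 * pi) / a) ^ DIM('a) * exp (- (norm y / a)\<^sup>2 / 2))"
  proof -
    have "(\<Prod>b\<in>Basis. LINT x|lborel. ?f b x) =
        (\<Prod>b\<in>Basis. complex_of_real (sqrt (2 * pi) / a * exp (- ((y \<bullet> b) / a)\<^sup>2 / 2)))"
      using f by (intro prod.cong) (auto simp: has_bochner_integral_iff)
    also have "\<dots> = complex_of_real ((sqrt (2 * pi) / a) ^ DIM('a) *
        exp (\<Sum>b\<in>Basis. - ((y \<bullet> b) / a)\<^sup>2 / 2))"
      by (simp only: prod.distrib exp_sum finite_Basis of_real_mult of_real_prod prod_constant of_real_power)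
    also have "(\<Sum>b\<in>Basis. - ((y \<bullet> b) / a)\<^sup>2 / 2) = - (norm y / a)\<^sup>2 / 2"
      unfolding power_divide power2_norm_eq_inner euclidean_inner[of y y]
      by (simp add: sum_divide_distrib sum_negf power2_eq_square)
    finally show ?thesis .
  qed
  ultimately show ?thesis
    by simp
qed

subsection \<open>Gaussian regularization\<close>

text \<open>A majorant of product form makes the integrand integrable on the product space. The
  exchanges of Bochner integrals below all have such a majorant.\<close>

lemma Fubini_lborel_dominated:
  fixes H :: "'a::euclidean_space \<Rightarrow> 'b::euclidean_space \<Rightarrow> complex"
  assumes H [measurable]: "(\<lambda>(t, w). H t w) \<in> borel_measurable (lborel \<Otimes>\<^sub>M lborel)"
    and u: "integrable lborel u" and v: "integrable lborel v"
    and le: "\<And>t w. cmod (H t w) \<le> u t * v w"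
  shows "(LINT t|lborel. LINT w|lborel. H t w) = (LINT w|lborel. LINT t|lborel. H t w)"
proof -
  have int: "integrable lborel (\<lambda>w. H t w)" for t
  proof (rule Bochner_Integration.integrable_bound)
    show "integrable lborel (\<lambda>w. u t * v w)"
      using v by simp
    show "AE w in lborel. cmod (H t w) \<le> norm (u t * v w)"
      using order_trans[OF le abs_ge_self] by (intro AE_I2) simp
  qed measurable
  have "integrable (lborel \<Otimes>\<^sub>M lborel) (\<lambda>(t, w). H t w)"
  proof (rule lborel_pair.Fubini_integrable)
    show "integrable lborel (\<lambda>t. LINT w|lborel. norm (case (t, w) of (t, w) \<Rightarrow> H t w))"
    proof (rule Bochner_Integration.integrable_bound)
      show "integrable lborel (\<lambda>t. u t * (LINT w|lborel. v w))"
        using u by simp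
      have "(LINT w|lborel. cmod (H t w)) \<le> (LINT w|lborel. u t * v w)" for t
        using v int le by (intro integral_mono integrable_norm) auto
      then have "(LINT w|lborel. cmod (H t w)) \<le> \<bar>u t * (LINT w|lborel. v w)\<bar>" for t
        using abs_ge_self order_trans by fastforce
      then show "AE t in lborel. norm (LINT w|lborel. norm (case (t, w) of (t, w) \<Rightarrow> H t w))
                     \<le> norm (u t * (LINT w|lborel. v w))"
        by (intro AE_I2) simp
    qed measurable
  qed (use int in auto)
  from lborel_pair.Fubini_integral[OF this] show ?thesis
    by simp
qed

text \<open>The inverse Fourier transform of the Gaussian
  \<open>exp (- (a * norm \<omega>)\<^sup>2 / 2)\<close>. It has mass 1 and concentrates at the
  origin as \<open>a\<close> tends to 0, so it is an approximate identity.\<close>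

definition gauss_kernel :: "real \<Rightarrow> 'a::euclidean_space \<Rightarrow> real" where
  "gauss_kernel a y = (sqrt (2 * pi) / a) ^ DIM('a) * exp (- (2 * pi * norm y / a)\<^sup>2 / 2)"

lemma gauss_kernel_measurable [measurable]: "gauss_kernel a \<in> borel_measurable borel"
  unfolding gauss_kernel_def [abs_def] by measurable

lemma gauss_kernel_nonneg: "a > 0 \<Longrightarrow> 0 \<le> gauss_kernel a y"
  by (simp add: gauss_kernel_def)

lemma gauss_kernel_minus_commute: "gauss_kernel a (x - y) = gauss_kernel a (y - x)"
  by (simp add: gauss_kernel_def norm_minus_commute)

lemma gauss_kernel_scale:
  fixes z :: "'a::euclidean_space"
  shows "a > 0 \<Longrightarrow> a ^ DIM('a) * gauss_kernel a (a *\<^sub>R z) = gauss_kernel 1 z"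
  by (simp add: gauss_kernel_def power_divide power_mult_distrib)

lemma fourier_gaussian:
  fixes y :: "'a::euclidean_space"
  assumes "a > 0"
  shows "(LINT \<omega>|lborel. complex_of_real (exp (- (a * norm \<omega>)\<^sup>2 / 2)) * cis (2 * pi * (y \<bullet> \<omega>)))
     = complex_of_real (gauss_kernel a y)"
  using gaussian_integral_cis[OF assms, of "(2 * pi) *\<^sub>R y"]
  by (simp add: has_bochner_integral_iff gauss_kernel_def inner_commute)

lemma integrable_gaussian:
  assumes "a > 0"
  shows "integrable lborel (\<lambda>x::'a::euclidean_space. exp (- (a * norm x)\<^sup>2 / 2))"
  using gaussian_integral_cis[OF assms, of "0::'a"]
  by (auto simp: has_bochner_integral_iff complex_of_real_integrable_eq simp del: of_real_exp)

lemma gauss_kernel_has_integral: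
  assumes a: "a > 0"
  shows "has_bochner_integral lborel (gauss_kernel a :: 'a::euclidean_space \<Rightarrow> real) 1"
proof -
  let ?c = "(sqrt (2 * pi) / a) ^ DIM('a)"
  have eq: "gauss_kernel a x = ?c * exp (- (2 * pi / a * norm x)\<^sup>2 / 2)" for x :: 'a
    by (simp add: gauss_kernel_def)
  have "sqrt (2 * pi) * sqrt (2 * pi) = 2 * pi"
    by simp
  \<comment> \<open>The kernel is a Gaussian of parameter \<open>2 * pi / a\<close>; its normalizing
    factor and its integral in one coordinate cancel.\<close>
  then have one: "sqrt (2 * pi) / a * (sqrt (2 * pi) / (2 * pi / a)) = 1"
    using a by (simp add: field_simps)
  have "complex_of_real (LINT x::'a|lborel. exp (- (2 * pi / a * norm x)\<^sup>2 / 2))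
      = complex_of_real ((sqrt (2 * pi) / (2 * pi / a)) ^ DIM('a))"
    using gaussian_integral_cis[of "2 * pi / a" "0::'a"] a
    by (simp add: has_bochner_integral_iff flip: integral_complex_of_real of_real_exp)
  then have "(LINT x::'a|lborel. exp (- (2 * pi / a * norm x)\<^sup>2 / 2))
      = (sqrt (2 * pi) / (2 * pi / a)) ^ DIM('a)"
    using of_real_eq_iff by blast
  then have "(LINT x::'a|lborel. gauss_kernel a x) = (sqrt (2 * pi) / a * (sqrt (2 * pi) / (2 * pi / a))) ^ DIM('a)"
    by (simp only: eq integral_mult_right_zero power_mult_distrib)
  moreover have "integrable lborel (gauss_kernel a :: 'a \<Rightarrow> real)"
    using integrable_gaussian[of "2 * pi / a", where 'a='a] a
    unfolding eq[abs_def] by (intro integrable_mult_right) auto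
  ultimately show ?thesis
    unfolding one by (simp add: has_bochner_integral_iff)
qed

lemma nn_integral_gauss_kernel:
  fixes x :: "'a::euclidean_space"
  assumes "a > 0"
  shows "(\<integral>\<^sup>+y. gauss_kernel a (x - y) \<partial>lborel) = 1"
proof -
  have "(\<integral>\<^sup>+y. gauss_kernel a (x - y) \<partial>lborel) = (\<integral>\<^sup>+y. gauss_kernel a (y :: 'a) \<partial>lborel)"
    by (rule nn_integral_lborel_reflect) measurable
  then show ?thesis
    using gauss_kernel_has_integral[OF assms, where 'a='a] gauss_kernel_nonneg[OF assms, where 'a='a]
    by (simp add: has_bochner_integral_iff nn_integral_eq_integral)
qed

text \<open>The substitution \<open>y = x - a n * z\<close> moves the dependence on \<open>n\<close>
  from the kernel into the argument of \<open>\<phi>\<close>. Continuity at \<open>x\<close> then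
  gives pointwise convergence, with the integrable majorant
  \<open>B * gauss_kernel 1 z\<close>.\<close>

lemma gauss_kernel_tendsto:
  fixes \<phi> :: "'a::euclidean_space \<Rightarrow> complex"
  assumes [measurable]: "\<phi> \<in> borel_measurable borel"
    and bound: "\<And>y. cmod (\<phi> y) \<le> B" and cont: "isCont \<phi> x"
    and a: "\<And>n. a n > 0" "a \<longlonglongrightarrow> 0"
  shows "(\<lambda>n. LINT y|lborel. \<phi> y * of_real (gauss_kernel (a n) (x - y))) \<longlonglongrightarrow> \<phi> x"
proof -
  have eq: "(LINT y|lborel. \<phi> y * of_real (gauss_kernel (a n) (x - y)))
      = (LINT z|lborel. \<phi> (x - a n *\<^sub>R z) * of_real (gauss_kernel 1 z))" for n
  proof -
    have "(LINT y|lborel. \<phi> y * of_real (gauss_kernel (a n) (x - y)))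
        = (LINT z|lborel. a n ^ DIM('a) *\<^sub>R
            (\<phi> (x - a n *\<^sub>R z) * of_real (gauss_kernel (a n) (a n *\<^sub>R z))))"
      using a(1)[of n] by (subst integral_lborel_affine[of "- a n" _ x]) auto
    also have "\<dots> = (LINT z|lborel. \<phi> (x - a n *\<^sub>R z) * of_real (gauss_kernel 1 z))"
      by (intro Bochner_Integration.integral_cong)
         (auto simp: scaleR_conv_of_real gauss_kernel_scale[OF a(1)[of n], symmetric])
    finally show ?thesis .
  qed
  have int1: "integrable lborel (gauss_kernel 1 :: 'a \<Rightarrow> real)" "(LINT z|lborel. gauss_kernel 1 (z :: 'a)) = 1"
    using gauss_kernel_has_integral[of 1, where 'a='a] by (auto simp: has_bochner_integral_iff)
  have "(\<lambda>n. LINT z|lborel. \<phi> (x - a n *\<^sub>R z) * of_real (gauss_kernel 1 z))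
     \<longlonglongrightarrow> (LINT z::'a|lborel. \<phi> x * of_real (gauss_kernel 1 z))"
  proof (rule integral_dominated_convergence)
    show "integrable lborel (\<lambda>z::'a. B * gauss_kernel 1 z)"
      using int1 by simp
    show "AE z::'a in lborel. (\<lambda>n. \<phi> (x - a n *\<^sub>R z) * of_real (gauss_kernel 1 z))
       \<longlonglongrightarrow> \<phi> x * of_real (gauss_kernel 1 z)"
    proof (intro AE_I2 tendsto_mult tendsto_const)
      fix z
      have "(\<lambda>n. x - a n *\<^sub>R z) \<longlonglongrightarrow> x - 0 *\<^sub>R z"
        by (intro tendsto_intros a)
      then show "(\<lambda>n. \<phi> (x - a n *\<^sub>R z)) \<longlonglongrightarrow> \<phi> x"
        by (intro isCont_tendsto_compose[OF cont]) simp
    qed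
    show "AE z in lborel. cmod (\<phi> (x - a n *\<^sub>R z) * of_real (gauss_kernel 1 z)) \<le> B * gauss_kernel 1 z" for n
      by (intro AE_I2) (auto simp: norm_mult gauss_kernel_nonneg bound intro!: mult_right_mono)
  qed measurable
  then show ?thesis
    by (simp add: eq int1)
qed

text \<open>Completing the measure does not change the integral of a Borel function. The analysis
  therefore takes place over \<open>lborel\<close>, where product measures and Fubini's theorem
  apply directly.\<close>

lemma fourier_integral_lborel:
  assumes [measurable]: "f \<in> borel_measurable borel"
  shows "fourier_integral f \<omega> = (LINT x|lborel. f x * cis (- (2 * pi * (x \<bullet> \<omega>))))"
  unfolding fourier_integral_def by (rule integral_completion) measurable

lemma fourier_integral_measurable [measurable]:
  assumes [measurable]: "f \<in> borel_measurable borel"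
  shows "fourier_integral f \<in> borel_measurable borel"
  unfolding fourier_integral_lborel[OF assms, abs_def] by measurable

lemma norm_fourier_integral_le:
  assumes [measurable]: "f \<in> borel_measurable borel"
  shows "cmod (fourier_integral f \<omega>) \<le> (LINT x|lborel. cmod (f x))"
  unfolding fourier_integral_lborel[OF assms]
  by (rule order_trans[OF integral_norm_bound]) (simp add: norm_mult)

lemma integrable_mult_cis:
  assumes f: "integrable lborel f" and [measurable]: "p \<in> borel_measurable borel"
  shows "integrable lborel (\<lambda>x. f x * cis (p x))"
proof (rule Bochner_Integration.integrable_bound[OF f])
  have [measurable]: "f \<in> borel_measurable borel"
    using f by auto
  show "(\<lambda>x. f x * cis (p x)) \<in> borel_measurable lborel"
    by measurable
qed (simp add: norm_mult)

text \<open>Expand the transform and exchange the integrals; the integral over \<omega> of the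
  Gaussian against a character is the kernel. The Gaussian factor makes the double integral converge
  absolutely even when the transform of \<open>f\<close> is not integrable.\<close>

lemma fourier_integral_regularized_inverse:
  fixes f :: "'a::euclidean_space \<Rightarrow> complex"
  assumes f: "integrable lborel f" and a: "a > 0"
  shows "(LINT \<omega>|lborel. fourier_integral f \<omega> * cis (2 * pi * (x \<bullet> \<omega>)) * of_real (exp (- (a * norm \<omega>)\<^sup>2 / 2)))
       = (LINT t|lborel. f t * of_real (gauss_kernel a (x - t)))"
proof -
  have [measurable]: "f \<in> borel_measurable borel"
    using f by auto
  let ?w = "\<lambda>\<omega>::'a. exp (- (a * norm \<omega>)\<^sup>2 / 2)"
  let ?H = "\<lambda>t \<omega>. f t * (complex_of_real (?w \<omega>) * cis (2 * pi * ((x - t) \<bullet> \<omega>)))"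
  have "(LINT t|lborel. f t * of_real (gauss_kernel a (x - t))) = (LINT t|lborel. LINT \<omega>|lborel. ?H t \<omega>)"
    by (simp only: integral_mult_right_zero fourier_gaussian[OF a])
  also have "\<dots> = (LINT \<omega>|lborel. LINT t|lborel. ?H t \<omega>)"
    by (rule Fubini_lborel_dominated[OF _ integrable_norm[OF f] integrable_gaussian[OF a]])
       (auto simp: norm_mult)
  also have "\<dots> = (LINT \<omega>|lborel. fourier_integral f \<omega> * cis (2 * pi * (x \<bullet> \<omega>)) * of_real (?w \<omega>))"
  proof (intro Bochner_Integration.integral_cong refl)
    fix \<omega>
    have "(LINT t|lborel. ?H t \<omega>) = (LINT t|lborel. (cis (2 * pi * (x \<bullet> \<omega>)) * of_real (?w \<omega>)) *
         (f t * cis (- (2 * pi * (t \<bullet> \<omega>)))))"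
      by (intro Bochner_Integration.integral_cong refl)
         (simp add: inner_diff_left right_diff_distrib cis_divide[symmetric] flip: cis_inverse, simp add: field_simps)
    then show "(LINT t|lborel. ?H t \<omega>) =
       fourier_integral f \<omega> * cis (2 * pi * (x \<bullet> \<omega>)) * of_real (?w \<omega>)"
      by (simp add: fourier_integral_lborel integral_mult_right_zero del: of_real_exp)
  qed
  finally show ?thesis ..
qed

subsection \<open>The Plancherel inequality\<close>

lemma borel_measurable_cnj [measurable]: "cnj \<in> borel_measurable borel"
  by (intro borel_measurable_continuous_onI continuous_intros)

text \<open>For a function that is not integrable the left side is 0 by the default value of the
  Bochner integral.\<close>

lemma ennreal_norm_integral_le:
  fixes f :: "_ \<Rightarrow> 'b::{banach, second_countable_topology}"
  shows "ennreal (norm (LINT x|M. f x)) \<le> (\<integral>\<^sup>+x. norm (f x) \<partial>M)"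
  by (cases "integrable M f") (auto simp: integral_norm_bound_ennreal not_integrable_integral_eq)

text \<open>A Schur test: bound \<open>p t * p s\<close> by half the sum of the squares, and use
  that the kernel is symmetric with mass 1 in each variable.\<close>

lemma nn_integral_gauss_kernel_quadratic_form_le:
  fixes p :: "'a::euclidean_space \<Rightarrow> real"
  assumes [measurable]: "p \<in> borel_measurable borel" and a: "a > 0"
  shows "(\<integral>\<^sup>+t. \<integral>\<^sup>+s. ennreal (p t * p s * gauss_kernel a (t - s)) \<partial>lborel \<partial>lborel)
       \<le> (\<integral>\<^sup>+t. ennreal ((p t)\<^sup>2) \<partial>lborel)"
proof -
  let ?k = "gauss_kernel a :: 'a \<Rightarrow> real"
  let ?f = "\<lambda>t s. ennreal ((p t)\<^sup>2 * ?k (t - s) / 2)"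
  let ?I = "\<integral>\<^sup>+t. ennreal ((p t)\<^sup>2) \<partial>lborel"
  note nonneg = gauss_kernel_nonneg[OF a]
  have one: "(\<integral>\<^sup>+t. \<integral>\<^sup>+s. ?f t s \<partial>lborel \<partial>lborel) = ?I / 2"
  proof -
    have "(\<integral>\<^sup>+s. ?f t s \<partial>lborel) = ennreal ((p t)\<^sup>2 / 2)" for t
    proof -
      have "(\<integral>\<^sup>+s. ?f t s \<partial>lborel) = (\<integral>\<^sup>+s. ennreal ((p t)\<^sup>2 / 2) * ennreal (?k (t - s)) \<partial>lborel)"
        by (intro nn_integral_cong) (simp add: nonneg flip: ennreal_mult)
      also have "\<dots> = ennreal ((p t)\<^sup>2 / 2) * (\<integral>\<^sup>+s. ennreal (?k (t - s)) \<partial>lborel)"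
        by (rule nn_integral_cmult) measurable
      finally show ?thesis
        by (simp add: nn_integral_gauss_kernel[OF a])
    qed
    then have "(\<integral>\<^sup>+t. \<integral>\<^sup>+s. ?f t s \<partial>lborel \<partial>lborel) = (\<integral>\<^sup>+t. ennreal ((p t)\<^sup>2) / 2 \<partial>lborel)"
      by (simp add: ennreal_divide_numeral)
    also have "\<dots> = ?I / 2"
      by (rule nn_integral_divide) measurable
    finally show ?thesis .
  qed
  have two: "(\<integral>\<^sup>+t. \<integral>\<^sup>+s. ?f s t \<partial>lborel \<partial>lborel) = ?I / 2"
    unfolding one[symmetric] by (rule lborel_pair.Fubini') measurable
  have "(\<integral>\<^sup>+t. \<integral>\<^sup>+s. ennreal (p t * p s * ?k (t - s)) \<partial>lborel \<partial>lborel)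
      \<le> (\<integral>\<^sup>+t. \<integral>\<^sup>+s. (?f t s + ?f s t) \<partial>lborel \<partial>lborel)"
  proof (intro nn_integral_mono)
    fix t s
    have "p t * p s \<le> (p t)\<^sup>2 / 2 + (p s)\<^sup>2 / 2"
      using sum_squares_bound[of "p t" "p s"] by simp
    from mult_right_mono[OF this nonneg, of "t - s"]
    have "ennreal (p t * p s * ?k (t - s)) \<le> ennreal ((p t)\<^sup>2 * ?k (t - s) / 2 + (p s)\<^sup>2 * ?k (s - t) / 2)"
      by (intro ennreal_leI) (simp add: gauss_kernel_minus_commute[of a s t] algebra_simps)
    also have "\<dots> = ?f t s + ?f s t"
      by (intro ennreal_plus) (simp_all add: nonneg)
    finally show "ennreal (p t * p s * ?k (t - s)) \<le> ?f t s + ?f s t" .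
  qed
  also have "\<dots> = (\<integral>\<^sup>+t. \<integral>\<^sup>+s. ?f t s \<partial>lborel \<partial>lborel) + (\<integral>\<^sup>+t. \<integral>\<^sup>+s. ?f s t \<partial>lborel \<partial>lborel)"
    by (simp add: nn_integral_add)
  \<comment> \<open>The case distinction covers an infinite \<open>?I\<close>.\<close>
  also have "\<dots> = ?I"
    unfolding one two by (cases ?I) (simp_all flip: ennreal_plus add: ennreal_divide_numeral ennreal_top_divide del: ennreal_plus)
  finally show ?thesis .
qed

text \<open>Write the squared modulus as the transform times its conjugate, expand one factor and
  exchange the integrals. The regularized inverse of the other factor is a Gaussian average of
  \<open>f\<close>, and what remains is the quadratic form of the kernel.\<close>

lemma Plancherel_regularized_le:
  fixes f :: "'a::euclidean_space \<Rightarrow> complex"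
  assumes f: "integrable lborel f" and a: "a > 0"
  shows "(\<integral>\<^sup>+\<omega>. ennreal ((cmod (fourier_integral f \<omega>))\<^sup>2 * exp (- (a * norm \<omega>)\<^sup>2 / 2)) \<partial>lborel)
       \<le> (\<integral>\<^sup>+x. ennreal ((cmod (f x))\<^sup>2) \<partial>lborel)"
proof -
  have [measurable]: "f \<in> borel_measurable borel"
    using f by auto
  let ?w = "\<lambda>\<omega>::'a. exp (- (a * norm \<omega>)\<^sup>2 / 2)"
  let ?k = "gauss_kernel a :: 'a \<Rightarrow> real"
  let ?F = "fourier_integral f"
  define C where "C = (LINT x|lborel. cmod (f x))"
  have C: "cmod (?F \<omega>) \<le> C" for \<omega>
    unfolding C_def by (rule norm_fourier_integral_le) measurable
  have C0: "0 \<le> C"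
    by (simp add: C_def)
  have wint: "integrable lborel ?w"
    by (rule integrable_gaussian[OF a])
  let ?H = "\<lambda>t \<omega>. f t * (cnj (?F \<omega>) * of_real (?w \<omega>) * cis (- (2 * pi * (t \<bullet> \<omega>))))"
  have int: "integrable lborel (\<lambda>\<omega>. (cmod (?F \<omega>))\<^sup>2 * ?w \<omega>)"
  proof (rule Bochner_Integration.integrable_bound)
    show "integrable lborel (\<lambda>\<omega>. C\<^sup>2 * ?w \<omega>)"
      using wint by simp
  qed (auto intro!: AE_I2 power_mono C)
  define J where "J = (LINT \<omega>|lborel. (cmod (?F \<omega>))\<^sup>2 * ?w \<omega>)"
  have J: "0 \<le> J"
    by (simp add: J_def)
  have "complex_of_real J = (LINT \<omega>|lborel. complex_of_real ((cmod (?F \<omega>))\<^sup>2 * ?w \<omega>))"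
    unfolding J_def by (rule integral_complex_of_real[symmetric])
  also have "\<dots> = (LINT \<omega>|lborel. LINT t|lborel. ?H t \<omega>)"
  proof (intro Bochner_Integration.integral_cong refl)
    fix \<omega>
    have "(LINT t|lborel. ?H t \<omega>)
        = (LINT t|lborel. (cnj (?F \<omega>) * of_real (?w \<omega>)) * (f t * cis (- (2 * pi * (t \<bullet> \<omega>)))))"
      by (simp add: mult_ac)
    also have "\<dots> = (cnj (?F \<omega>) * of_real (?w \<omega>)) * ?F \<omega>"
      by (simp add: fourier_integral_lborel del: of_real_exp)
    finally show "complex_of_real ((cmod (?F \<omega>))\<^sup>2 * ?w \<omega>) = (LINT t|lborel. ?H t \<omega>)"
      unfolding of_real_mult complex_norm_square by (simp add: mult_ac del: of_real_exp)
  qed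
  also have "\<dots> = (LINT t|lborel. LINT \<omega>|lborel. ?H t \<omega>)"
  proof (rule Fubini_lborel_dominated[symmetric, OF _ integrable_norm[OF f]])
    show "integrable lborel (\<lambda>\<omega>. C * ?w \<omega>)"
      using wint by simp
    show "cmod (?H t \<omega>) \<le> cmod (f t) * (C * ?w \<omega>)" for t \<omega>
      by (auto simp: norm_mult intro!: mult_left_mono mult_right_mono C)
  qed measurable
  also have "\<dots> = (LINT t|lborel. f t * cnj (LINT s|lborel. f s * of_real (?k (t - s))))"
  proof (intro Bochner_Integration.integral_cong refl)
    fix t
    have "(LINT \<omega>|lborel. cnj (?F \<omega>) * of_real (?w \<omega>) * cis (- (2 * pi * (t \<bullet> \<omega>))))
        = (LINT \<omega>|lborel. cnj (?F \<omega> * cis (2 * pi * (t \<bullet> \<omega>)) * of_real (?w \<omega>)))"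
      by (intro Bochner_Integration.integral_cong refl) (simp add: cis_cnj del: of_real_exp)
    also have "\<dots> = cnj (LINT \<omega>|lborel. ?F \<omega> * cis (2 * pi * (t \<bullet> \<omega>)) * of_real (?w \<omega>))"
      by (rule Bochner_Integration.integral_cnj)
    also have "\<dots> = cnj (LINT s|lborel. f s * of_real (?k (t - s)))"
      by (simp only: fourier_integral_regularized_inverse[OF f a])
    finally show "(LINT \<omega>|lborel. ?H t \<omega>) = f t * cnj (LINT s|lborel. f s * of_real (?k (t - s)))"
      by simp
  qed
  \<comment> \<open>As \<open>J\<close> is nonnegative it equals the norm of the complex integral,
    and the estimates can pass to absolute values.\<close>
  finally have "ennreal J = ennreal (cmod (LINT t|lborel. f t * cnj (LINT s|lborel. f s * of_real (?k (t - s)))))"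
    using J by (metis norm_of_real abs_of_nonneg)
  also have "\<dots> \<le> (\<integral>\<^sup>+t. ennreal (cmod (f t * cnj (LINT s|lborel. f s * of_real (?k (t - s))))) \<partial>lborel)"
    by (rule ennreal_norm_integral_le)
  also have "\<dots> \<le> (\<integral>\<^sup>+t. \<integral>\<^sup>+s. ennreal (cmod (f t) * cmod (f s) * ?k (t - s)) \<partial>lborel \<partial>lborel)"
  proof (rule nn_integral_mono)
    fix t
    have "ennreal (cmod (f t * cnj (LINT s|lborel. f s * of_real (?k (t - s)))))
       = ennreal (cmod (f t)) * ennreal (cmod (LINT s|lborel. f s * of_real (?k (t - s))))"
      by (simp add: norm_mult ennreal_mult)
    also have "\<dots> \<le> ennreal (cmod (f t)) * (\<integral>\<^sup>+s. cmod (f s * of_real (?k (t - s))) \<partial>lborel)"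
      by (intro mult_left_mono ennreal_norm_integral_le) auto
    also have "\<dots> = (\<integral>\<^sup>+s. ennreal (cmod (f t)) * cmod (f s * of_real (?k (t - s))) \<partial>lborel)"
      by (rule nn_integral_cmult[symmetric]) measurable
    also have "\<dots> = (\<integral>\<^sup>+s. ennreal (cmod (f t) * cmod (f s) * ?k (t - s)) \<partial>lborel)"
      using gauss_kernel_nonneg[OF a, where 'a='a]
      by (intro nn_integral_cong) (simp add: norm_mult mult.assoc flip: ennreal_mult)
    finally show "ennreal (cmod (f t * cnj (LINT s|lborel. f s * of_real (?k (t - s)))))
        \<le> (\<integral>\<^sup>+s. ennreal (cmod (f t) * cmod (f s) * ?k (t - s)) \<partial>lborel)" .
  qed
  also have "\<dots> \<le> (\<integral>\<^sup>+x. ennreal ((cmod (f x))\<^sup>2) \<partial>lborel)"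
    by (rule nn_integral_gauss_kernel_quadratic_form_le[OF _ a]) measurable
  also have "ennreal J = (\<integral>\<^sup>+\<omega>. ennreal ((cmod (?F \<omega>))\<^sup>2 * ?w \<omega>) \<partial>lborel)"
    unfolding J_def by (rule nn_integral_eq_integral[symmetric, OF int]) simp
  finally show ?thesis .
qed

text \<open>\<open>Suc n\<close> keeps the parameter of the Gaussian positive for every
  \<open>n\<close>, including 0.\<close>

lemma gaussian_width_tendsto_1:
  "(\<lambda>n. exp (- (inverse (real (Suc n)) * c)\<^sup>2 / 2)) \<longlonglongrightarrow> 1"
proof -
  have "(\<lambda>n. exp (- (inverse (real (Suc n)) * c)\<^sup>2 / 2)) \<longlonglongrightarrow> exp (- (0 * c)\<^sup>2 / 2)"
    by (intro tendsto_intros LIMSEQ_inverse_real_of_nat) simp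
  then show ?thesis
    by simp
qed

text \<open>Fatou's lemma as the Gaussian factor tends to 1. The bound holds in
  \<open>ennreal\<close>, so \<open>f\<close> may have infinite square integral.\<close>

theorem Plancherel_le:
  fixes f :: "'a::euclidean_space \<Rightarrow> complex"
  assumes f: "integrable lborel f"
  shows "(\<integral>\<^sup>+\<omega>. ennreal ((cmod (fourier_integral f \<omega>))\<^sup>2) \<partial>lborel)
       \<le> (\<integral>\<^sup>+x. ennreal ((cmod (f x))\<^sup>2) \<partial>lborel)"
proof -
  have [measurable]: "f \<in> borel_measurable borel"
    using f by auto
  let ?u = "\<lambda>n \<omega>. ennreal ((cmod (fourier_integral f \<omega>))\<^sup>2 * exp (- (inverse (real (Suc n)) * norm \<omega>)\<^sup>2 / 2))"
  have lim: "(\<lambda>n. ?u n \<omega>) \<longlonglongrightarrow> ennreal ((cmod (fourier_integral f \<omega>))\<^sup>2)" for \<omega>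
    using tendsto_mult[OF tendsto_const gaussian_width_tendsto_1] by (intro tendsto_ennrealI) simp
  have "(\<integral>\<^sup>+\<omega>. ennreal ((cmod (fourier_integral f \<omega>))\<^sup>2) \<partial>lborel)
      = (\<integral>\<^sup>+\<omega>. liminf (\<lambda>n. ?u n \<omega>) \<partial>lborel)"
    using lim_imp_Liminf[OF sequentially_bot lim] by simp
  also have "\<dots> \<le> liminf (\<lambda>n. \<integral>\<^sup>+\<omega>. ?u n \<omega> \<partial>lborel)"
    by (rule nn_integral_liminf) measurable
  also have "\<dots> \<le> (\<integral>\<^sup>+x. ennreal ((cmod (f x))\<^sup>2) \<partial>lborel)"
    using Plancherel_regularized_le[OF f]
    by (intro Liminf_le always_eventually allI) simp_all
  finally show ?thesis .
qed

subsection \<open>Fourier inversion\<close>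

text \<open>Lebesgue differentiation: at almost every point the difference is the limit of its means
  over shrinking cubes, and all these means are 0.\<close>

lemma AE_eq_if_cbox_integrals_eq:
  fixes f h :: "'a::euclidean_space \<Rightarrow> 'b::euclidean_space"
  assumes [measurable]: "f \<in> borel_measurable borel" "h \<in> borel_measurable borel"
    and f: "\<And>l u. set_integrable lborel (cbox l u) f"
    and h: "\<And>l u. set_integrable lborel (cbox l u) h"
    and eq: "\<And>l u. (LINT x:cbox l u|lborel. f x) = (LINT x:cbox l u|lborel. h x)"
  shows "AE x in lborel. f x = h x"
proof -
  let ?u = "\<lambda>x. f x - h x"
  have int: "set_integrable lborel (cbox l u) ?u" for l u
    by (intro set_integral_diff f h)
  have zero: "integral (cbox l u) ?u = 0" for l u
    using set_borel_integral_eq_integral(2)[OF int, of l u] set_integral_diff(2)[OF f h, of l u] eq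
    by simp
  obtain N where N: "negligible N"
    and lim: "\<And>x e. \<lbrakk>x \<notin> N; 0 < e\<rbrakk> \<Longrightarrow> \<exists>d>0. \<forall>k. 0 < k \<and> k < d \<longrightarrow>
        norm (integral (cbox x (x + k *\<^sub>R One)) ?u /\<^sub>R k ^ DIM('a) - ?u x) < e"
  proof (rule integrable_ccontinuous_explicit[of ?u, OF set_borel_integral_eq_integral(1)[OF int]], goal_cases)
    case (1 N)
    show ?case
      by (rule 1(1)[OF 1(2,3)])
  qed
  have "?u x = 0" if x: "x \<notin> N" for x
  proof (rule ccontr)
    assume "?u x \<noteq> 0"
    with lim[OF x, of "norm (?u x)"] obtain d where "d > 0"
      and "\<forall>k. 0 < k \<and> k < d \<longrightarrow> norm (integral (cbox x (x + k *\<^sub>R One)) ?u /\<^sub>R k ^ DIM('a) - ?u x) < norm (?u x)"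
      by auto
    \<comment> \<open>The mean over the cube of side \<open>d / 2\<close> is 0, so the bound would
      say that \<open>norm (?u x)\<close> is less than itself.\<close>
    from this(2)[rule_format, of "d / 2"] \<open>d > 0\<close> show False
      by (simp add: zero norm_minus_commute)
  qed
  then have "{x. ?u x \<noteq> 0} \<subseteq> N"
    by blast
  then have "{x. ?u x \<noteq> 0} \<in> null_sets lebesgue"
    using N negligible_subset negligible_iff_null_sets by blast
  \<comment> \<open>Being a Borel set, it is null for \<open>lborel\<close> and not only for the
    completion.\<close>
  moreover have "{x. ?u x \<noteq> 0} \<in> sets lborel"
    by measurable
  ultimately have "{x. ?u x \<noteq> 0} \<in> null_sets lborel"
    by (simp add: null_sets_completion_iff)
  then show ?thesis
    by (rule AE_I') auto
qed

text \<open>The regularized inverse transform is on the one hand a Gaussian average of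
  \<open>f\<close>, on the other hand an integral that converges to the unregularized one by
  dominated convergence. Comparing integrals over boxes avoids pointwise convergence of averages of
  a merely integrable function.\<close>

theorem Fourier_inversion:
  fixes f :: "'a::euclidean_space \<Rightarrow> complex"
  assumes f: "integrable lborel f" and F: "integrable lborel (fourier_integral f)"
  shows "AE x in lborel. f x = (LINT \<omega>|lborel. fourier_integral f \<omega> * cis (2 * pi * (x \<bullet> \<omega>)))"
proof -
  have [measurable]: "f \<in> borel_measurable borel"
    using f by auto
  let ?F = "fourier_integral f"
  let ?a = "\<lambda>n. inverse (real (Suc n))"
  define f0 where "f0 x = (LINT \<omega>|lborel. ?F \<omega> * cis (2 * pi * (x \<bullet> \<omega>)))" for x
  define M where "M n x = (LINT \<omega>|lborel. ?F \<omega> * cis (2 * pi * (x \<bullet> \<omega>)) *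
      of_real (exp (- (?a n * norm \<omega>)\<^sup>2 / 2)))" for n x
  define C where "C = (LINT \<omega>|lborel. cmod (?F \<omega>))"
  have C: "0 \<le> C"
    by (simp add: C_def)
  have [measurable]: "f0 \<in> borel_measurable borel"
    unfolding f0_def by measurable
  have [measurable]: "M n \<in> borel_measurable borel" for n
    unfolding M_def by measurable
  have f0_le: "cmod (f0 x) \<le> C" for x
    unfolding f0_def C_def by (rule order_trans[OF integral_norm_bound]) (simp add: norm_mult)
  have M_le: "cmod (M n x) \<le> C" for n x
    unfolding M_def C_def
    by (rule order_trans[OF integral_norm_bound], rule integral_mono'[OF integrable_norm[OF F]])
       (auto simp: norm_mult intro!: mult_left_le)
  have M_lim: "(\<lambda>n. M n x) \<longlonglongrightarrow> f0 x" for x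
    unfolding M_def f0_def
  proof (rule integral_dominated_convergence[OF _ _ integrable_norm[OF F]])
    have "(\<lambda>n. ?F \<omega> * cis (2 * pi * (x \<bullet> \<omega>)) * of_real (exp (- (?a n * norm \<omega>)\<^sup>2 / 2)))
       \<longlonglongrightarrow> ?F \<omega> * cis (2 * pi * (x \<bullet> \<omega>)) * of_real 1" for \<omega>
      by (intro tendsto_mult tendsto_const tendsto_of_real gaussian_width_tendsto_1)
    then show "AE \<omega> in lborel. (\<lambda>n. ?F \<omega> * cis (2 * pi * (x \<bullet> \<omega>)) * of_real (exp (- (?a n * norm \<omega>)\<^sup>2 / 2)))
       \<longlonglongrightarrow> ?F \<omega> * cis (2 * pi * (x \<bullet> \<omega>))"
      by simp
  qed (auto simp: norm_mult intro!: mult_left_le)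
  \<comment> \<open>Weak convergence of the regularizations suffices: their integrals over a box tend both to that
    of \<open>f0\<close> and, moving the kernel to the indicator function, to that of \<open>f\<close>.\<close>
  have box: "(LINT x:cbox l u|lborel. f x) = (LINT x:cbox l u|lborel. f0 x)" for l u
  proof -
    let ?I = "indicator (cbox l u) :: 'a \<Rightarrow> complex"
    have [measurable]: "?I \<in> borel_measurable borel"
      by measurable
    have Iint: "integrable lborel (indicator (cbox l u) :: 'a \<Rightarrow> real)"
      by (simp add: integrable_indicator_iff emeasure_lborel_cbox_eq)
    have 1: "(\<lambda>n. LINT x|lborel. ?I x * M n x) \<longlonglongrightarrow> (LINT x|lborel. ?I x * f0 x)"
    proof (rule integral_dominated_convergence)
      show "integrable lborel (\<lambda>x. indicator (cbox l u) x * C)"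
        using Iint by simp
      show "AE x in lborel. (\<lambda>n. ?I x * M n x) \<longlonglongrightarrow> ?I x * f0 x"
        by (intro AE_I2 tendsto_mult tendsto_const M_lim)
    qed (auto simp: norm_mult indicator_def M_le)
    have swap: "(LINT x|lborel. ?I x * M n x)
        = (LINT t|lborel. f t * (LINT x|lborel. ?I x * of_real (gauss_kernel (?a n) (t - x))))" for n
    proof -
      have an: "?a n > 0"
        by simp
      let ?H = "\<lambda>x t. ?I x * (f t * of_real (gauss_kernel (?a n) (x - t)))"
      \<comment> \<open>The peak value of the kernel; it bounds the kernel uniformly, which gives a
        majorant of product form.\<close>
      let ?c = "(sqrt (2 * pi) / ?a n) ^ DIM('a)"
      have k_le: "gauss_kernel (?a n) y \<le> ?c" for y :: 'a
        unfolding gauss_kernel_def by (intro mult_left_le) auto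
      have "(LINT x|lborel. ?I x * M n x) = (LINT x|lborel. LINT t|lborel. ?H x t)"
        by (simp only: M_def fourier_integral_regularized_inverse[OF f an] integral_mult_right_zero)
      also have "\<dots> = (LINT t|lborel. LINT x|lborel. ?H x t)"
      proof (rule Fubini_lborel_dominated[OF _ Iint])
        show "integrable lborel (\<lambda>t. cmod (f t) * ?c)"
          using f by simp
        show "cmod (?H x t) \<le> indicator (cbox l u) x * (cmod (f t) * ?c)" for x t
          using k_le[of "x - t"] gauss_kernel_nonneg[OF an, of "x - t"]
          by (auto simp: norm_mult indicator_def intro!: mult_left_mono)
      qed measurable
      also have "\<dots> = (LINT t|lborel. f t * (LINT x|lborel. ?I x * of_real (gauss_kernel (?a n) (t - x))))"
      proof (intro Bochner_Integration.integral_cong refl)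
        fix t
        have "(LINT x|lborel. ?H x t) = (LINT x|lborel. f t * (?I x * of_real (gauss_kernel (?a n) (t - x))))"
        proof (intro Bochner_Integration.integral_cong refl)
          fix x
          show "?H x t = f t * (?I x * of_real (gauss_kernel (?a n) (t - x)))"
            unfolding gauss_kernel_minus_commute[of _ x t] by (rule mult.left_commute)
        qed
        then show "(LINT x|lborel. ?H x t) = f t * (LINT x|lborel. ?I x * of_real (gauss_kernel (?a n) (t - x)))"
          by (simp only: integral_mult_right_zero)
      qed
      finally show ?thesis .
    qed
    have 2: "(\<lambda>n. LINT t|lborel. f t * (LINT x|lborel. ?I x * of_real (gauss_kernel (?a n) (t - x))))
        \<longlonglongrightarrow> (LINT t|lborel. f t * ?I t)"
    proof (rule integral_dominated_convergence[OF _ _ integrable_norm[OF f]])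
      \<comment> \<open>The indicator is continuous off the frontier of the box, so its Gaussian
        averages converge to it almost everywhere.\<close>
      have "frontier (cbox l u) \<in> null_sets lborel"
        using negligible_frontier_interval[of l u] borel_closed[OF frontier_closed[of "cbox l u"]]
        by (simp add: negligible_iff_null_sets null_sets_completion_iff frontier_cbox)
      then have "AE t in lborel. t \<notin> frontier (cbox l u)"
        by (rule AE_not_in)
      then show "AE t in lborel. (\<lambda>n. f t * (LINT x|lborel. ?I x * of_real (gauss_kernel (?a n) (t - x))))
          \<longlonglongrightarrow> f t * ?I t"
      proof eventually_elim
        fix t assume "t \<notin> frontier (cbox l u)"
        then have "isCont (\<lambda>x. complex_of_real (indicator (cbox l u) x)) t"
          using isCont_indicator[of t "cbox l u"] by (intro isCont_of_real) blast
        moreover have "(\<lambda>x. complex_of_real (indicator (cbox l u) x)) = ?I"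
          by (auto simp: indicator_def)
        ultimately have "isCont ?I t"
          by (simp only:)
        then show "(\<lambda>n. f t * (LINT x|lborel. ?I x * of_real (gauss_kernel (?a n) (t - x))))
          \<longlonglongrightarrow> f t * ?I t"
          by (intro tendsto_mult tendsto_const gauss_kernel_tendsto[where B=1, OF _ _ \<open>isCont ?I t\<close>]
                LIMSEQ_inverse_real_of_nat) (simp_all add: indicator_def)
      qed
      show "AE t in lborel. cmod (f t * (LINT x|lborel. ?I x * of_real (gauss_kernel (?a n) (t - x))))
          \<le> cmod (f t)" for n
      proof (intro AE_I2)
        fix t
        have an: "?a n > 0"
          by simp
        have "ennreal (cmod (LINT x|lborel. ?I x * of_real (gauss_kernel (?a n) (t - x))))
          \<le> (\<integral>\<^sup>+x. ennreal (cmod (?I x * of_real (gauss_kernel (?a n) (t - x)))) \<partial>lborel)"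
          by (rule ennreal_norm_integral_le)
        also have "\<dots> \<le> (\<integral>\<^sup>+x. ennreal (gauss_kernel (?a n) (t - x)) \<partial>lborel)"
          using gauss_kernel_nonneg[OF an, where 'a='a]
          by (intro nn_integral_mono ennreal_leI) (simp add: norm_mult indicator_def)
        finally have "cmod (LINT x|lborel. ?I x * of_real (gauss_kernel (?a n) (t - x))) \<le> 1"
          unfolding nn_integral_gauss_kernel[OF an] by (simp only: ennreal_le_1)
        then show "cmod (f t * (LINT x|lborel. ?I x * of_real (gauss_kernel (?a n) (t - x)))) \<le> cmod (f t)"
          by (auto simp: norm_mult intro: mult_left_le)
      qed
    qed measurable
    have "(LINT t|lborel. f t * ?I t) = (LINT x|lborel. ?I x * f0 x)"
      using LIMSEQ_unique[OF 2 1[unfolded swap]] .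
    moreover have "indicator (cbox l u) x *\<^sub>R z = ?I x * z" for x z
      by (simp add: indicator_def)
    ultimately show ?thesis
      by (simp add: set_lebesgue_integral_def mult.commute)
  qed
  have "AE x in lborel. f x = f0 x"
  proof (rule AE_eq_if_cbox_integrals_eq[OF _ _ _ _ box])
    show "set_integrable lborel (cbox l u) f" for l u
      unfolding set_integrable_def using f by (intro integrable_mult_indicator) auto
    show "set_integrable lborel (cbox l u) f0" for l u
      unfolding set_integrable_def
    proof (rule Bochner_Integration.integrable_bound)
      show "integrable lborel (\<lambda>x. indicator (cbox l u) x * C)"
        by (intro integrable_mult_left) (simp add: integrable_indicator_iff emeasure_lborel_cbox_eq)
    qed (use C f0_le in \<open>auto simp: indicator_def\<close>)
  qed measurable
  then show ?thesis
    by (simp add: f0_def)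
qed

subsection \<open>The Fourier transform on square integrable functions\<close>

text \<open>A substitute for the triangle inequality in \<open>L2\<close> that stays with squared
  norms; the factor 2 is harmless in limits.\<close>

lemma ennreal_norm_diff_power2_le:
  fixes x y z :: "'a::real_normed_vector"
  shows "ennreal ((norm (x - y))\<^sup>2) \<le> 2 * ennreal ((norm (z - x))\<^sup>2) + 2 * ennreal ((norm (z - y))\<^sup>2)"
proof -
  have "(norm (x - y))\<^sup>2 \<le> (norm (z - x) + norm (z - y))\<^sup>2"
    using norm_triangle_ineq4[of "z - y" "z - x"] by (intro power_mono) (auto simp: algebra_simps)
  also have "\<dots> \<le> 2 * (norm (z - x))\<^sup>2 + 2 * (norm (z - y))\<^sup>2"
    using sum_squares_bound[of "norm (z - x)" "norm (z - y)"] by (simp add: power2_sum)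
  finally have "ennreal ((norm (x - y))\<^sup>2) \<le> ennreal (2 * (norm (z - x))\<^sup>2 + 2 * (norm (z - y))\<^sup>2)"
    by (rule ennreal_leI)
  then show ?thesis
    by (simp add: ennreal_plus ennreal_mult')
qed

lemma L2_limit_unique:
  fixes h k :: "'a \<Rightarrow> complex" and F :: "nat \<Rightarrow> 'a \<Rightarrow> complex"
  assumes [measurable]: "h \<in> borel_measurable M" "k \<in> borel_measurable M" "\<And>n. F n \<in> borel_measurable M"
    and h: "(\<lambda>n. \<integral>\<^sup>+x. ennreal ((cmod (F n x - h x))\<^sup>2) \<partial>M) \<longlonglongrightarrow> 0"
    and k: "(\<lambda>n. \<integral>\<^sup>+x. ennreal ((cmod (F n x - k x))\<^sup>2) \<partial>M) \<longlonglongrightarrow> 0"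
  shows "AE x in M. h x = k x"
proof -
  let ?D = "\<integral>\<^sup>+x. ennreal ((cmod (h x - k x))\<^sup>2) \<partial>M"
  have "?D \<le> 2 * (\<integral>\<^sup>+x. ennreal ((cmod (F n x - h x))\<^sup>2) \<partial>M) + 2 * (\<integral>\<^sup>+x. ennreal ((cmod (F n x - k x))\<^sup>2) \<partial>M)" for n
  proof -
    have "?D \<le> (\<integral>\<^sup>+x. (2 * ennreal ((cmod (F n x - h x))\<^sup>2) + 2 * ennreal ((cmod (F n x - k x))\<^sup>2)) \<partial>M)"
      by (intro nn_integral_mono ennreal_norm_diff_power2_le)
    then show ?thesis
      by (simp add: nn_integral_add nn_integral_cmult)
  qed
  moreover have "(\<lambda>n. 2 * (\<integral>\<^sup>+x. ennreal ((cmod (F n x - h x))\<^sup>2) \<partial>M) + 2 * (\<integral>\<^sup>+x. ennreal ((cmod (F n x - k x))\<^sup>2) \<partial>M))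
      \<longlonglongrightarrow> 2 * 0 + 2 * 0"
    by (intro tendsto_add ennreal_tendsto_cmult h k) auto
  ultimately have "?D \<le> 2 * 0 + 2 * 0"
    by (intro LIMSEQ_le_const) auto
  then have "?D = 0"
    by simp
  then have "AE x in M. ennreal ((cmod (h x - k x))\<^sup>2) = 0"
    by (subst (asm) nn_integral_0_iff_AE) measurable
  then show ?thesis
    by eventually_elim simp
qed

lemma nn_integral_power2_eq_integral:
  fixes f :: "'a \<Rightarrow> complex"
  assumes "integrable M (\<lambda>x. (cmod (f x))\<^sup>2)"
  shows "(\<integral>\<^sup>+x. ennreal ((cmod (f x))\<^sup>2) \<partial>M) = ennreal (LINT x|M. (cmod (f x))\<^sup>2)"
  using assms by (intro nn_integral_eq_integral) auto

text \<open>The error of the transform of a truncation is the transform of the tail up to sign. The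
  Plancherel inequality bounds it in \<open>L2\<close> by the tail itself, which tends to 0 by
  dominated convergence.\<close>

lemma is_fourier_L2_fourier_integral:
  fixes f :: "'a::euclidean_space \<Rightarrow> complex"
  assumes f: "integrable lborel f" and f2: "integrable lborel (\<lambda>x. (cmod (f x))\<^sup>2)"
  shows "is_fourier_L2 f (fourier_integral f)"
proof -
  have [measurable]: "f \<in> borel_measurable borel"
    using f by auto
  let ?B = "\<lambda>n. indicator (cball 0 (real n)) :: 'a \<Rightarrow> complex"
  let ?tr = "\<lambda>n x. ?B n x * f x"
  let ?tl = "\<lambda>n x. f x - ?tr n x"
  have [measurable]: "cball (0 :: 'a) (real n) \<in> sets borel" for n
    by simp
  have tr [measurable]: "?tr n \<in> borel_measurable borel" for n
    by measurable
  have tr_int: "integrable lborel (?tr n)" for n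
    by (rule Bochner_Integration.integrable_bound[OF f]) (auto simp: indicator_def)
  have tl_int: "integrable lborel (?tl n)" for n
    using f tr_int by (rule Bochner_Integration.integrable_diff)
  have diff: "fourier_integral (?tl n) \<omega> = fourier_integral f \<omega> - fourier_integral (?tr n) \<omega>" for n \<omega>
    using integrable_mult_cis[OF f] integrable_mult_cis[OF tr_int]
    by (simp add: fourier_integral_lborel left_diff_distrib)
  have "(\<lambda>n. \<integral>\<^sup>+x. ennreal ((cmod (?tl n x))\<^sup>2) \<partial>lborel) \<longlonglongrightarrow> (\<integral>\<^sup>+x. 0 \<partial>(lborel :: 'a measure))"
  proof (rule nn_integral_dominated_convergence)
    show "AE x in lborel. ennreal ((cmod (?tl n x))\<^sup>2) \<le> ennreal ((cmod (f x))\<^sup>2)" for n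
      by (intro AE_I2) (auto simp: indicator_def)
    show "(\<integral>\<^sup>+x. ennreal ((cmod (f x))\<^sup>2) \<partial>lborel) < \<infinity>"
      unfolding nn_integral_power2_eq_integral[OF f2] by simp
    show "AE x::'a in lborel. (\<lambda>n. ennreal ((cmod (?tl n x))\<^sup>2)) \<longlonglongrightarrow> 0"
    proof (intro AE_I2 tendsto_eventually)
      fix x :: 'a
      have "\<forall>\<^sub>F n in sequentially. real n \<ge> norm x"
        by (rule eventually_sequentiallyI[of "nat \<lceil>norm x\<rceil>"]) linarith
      then show "\<forall>\<^sub>F n in sequentially. ennreal ((cmod (?tl n x))\<^sup>2) = 0"
        by eventually_elim (simp add: indicator_def)
    qed
  qed measurable
  then have lim0: "(\<lambda>n. \<integral>\<^sup>+x. ennreal ((cmod (?tl n x))\<^sup>2) \<partial>lborel) \<longlonglongrightarrow> 0"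
    by simp
  have "(\<lambda>n. \<integral>\<^sup>+\<omega>. ennreal ((cmod (fourier_integral (?tr n) \<omega> - fourier_integral f \<omega>))\<^sup>2) \<partial>lborel) \<longlonglongrightarrow> 0"
  proof (rule tendsto_sandwich[OF _ _ tendsto_const lim0])
    show "\<forall>\<^sub>F n in sequentially.
        (\<integral>\<^sup>+\<omega>. ennreal ((cmod (fourier_integral (?tr n) \<omega> - fourier_integral f \<omega>))\<^sup>2) \<partial>lborel)
        \<le> (\<integral>\<^sup>+x. ennreal ((cmod (?tl n x))\<^sup>2) \<partial>lborel)"
      using Plancherel_le[OF tl_int] by (simp add: diff norm_minus_commute)
  qed auto
  moreover have "fourier_integral f \<in> L2"
  proof -
    have "(\<integral>\<^sup>+\<omega>. ennreal ((cmod (fourier_integral f \<omega>))\<^sup>2) \<partial>lborel) < \<infinity>"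
      using Plancherel_le[OF f] unfolding nn_integral_power2_eq_integral[OF f2]
      by (rule le_less_trans) simp
    then have "integrable lborel (\<lambda>\<omega>. (cmod (fourier_integral f \<omega>))\<^sup>2)"
      by (simp add: integrable_iff_bounded)
    then show ?thesis
      by (auto simp: L2_def integrable_completion intro: measurable_completion)
  qed
  ultimately show ?thesis
    by (simp add: is_fourier_L2_def nn_integral_completion)
qed

lemma fourier_L2_eq_fourier_integral:
  fixes f :: "'a::euclidean_space \<Rightarrow> complex"
  assumes f: "integrable lborel f" and f2: "integrable lborel (\<lambda>x. (cmod (f x))\<^sup>2)"
  shows "AE \<omega> in lebesgue. fourier_L2 f \<omega> = fourier_integral f \<omega>"
proof -
  have [measurable]: "f \<in> borel_measurable borel"
    using f by auto
  have 1: "is_fourier_L2 f (fourier_integral f)"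
    by (rule is_fourier_L2_fourier_integral[OF assms])
  \<comment> \<open>The Fourier integral witnesses existence, so the chosen function satisfies the
    specification; uniqueness of limits in \<open>L2\<close> then identifies the two.\<close>
  then have 2: "is_fourier_L2 f (fourier_L2 f)"
    unfolding fourier_L2_def by (rule someI[of "is_fourier_L2 f"])
  have [measurable]: "cball (0 :: 'a) (real n) \<in> sets borel" for n
    by simp
  show ?thesis
  proof (rule L2_limit_unique)
    show "fourier_integral (\<lambda>x. indicator (cball 0 (real n)) x * f x) \<in> borel_measurable lebesgue" for n
      by (intro measurable_completion) measurable
  qed (use 1 2 in \<open>auto simp: is_fourier_L2_def L2_def\<close>)
qed

subsection \<open>The short-time Fourier transform\<close>

lemma integrable_lborel_prod_mult:
  fixes u :: "'a::euclidean_space \<Rightarrow> real" and v :: "'b::euclidean_space \<Rightarrow> real"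
  assumes u: "integrable lborel u" and v: "integrable lborel v"
  shows "integrable (lborel \<Otimes>\<^sub>M lborel) (\<lambda>(x, y). u x * v y)"
proof (rule lborel_pair.Fubini_integrable)
  have [measurable]: "u \<in> borel_measurable borel" "v \<in> borel_measurable borel"
    using u v by auto
  show "(\<lambda>(x, y). u x * v y) \<in> borel_measurable (lborel \<Otimes>\<^sub>M lborel)"
    by measurable
  show "integrable lborel (\<lambda>x. LINT y|lborel. norm (case (x, y) of (x, y) \<Rightarrow> u x * v y))"
    using u by (simp add: abs_mult)
qed (use v in auto)

text \<open>The weighted autocorrelation is bounded by the autocorrelation of the weighted function
  \<open>q\<close>, whose integral is the square of the integral of \<open>q\<close>. The square
  root is then removed by an inequality between products and squares.\<close>

lemma sqrt_autocorrelation_weighted_integrable: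
  fixes p :: "'a::euclidean_space \<Rightarrow> real" and r \<alpha> :: real
  assumes [measurable]: "p \<in> borel_measurable borel" and p0: "\<And>x. 0 \<le> p x"
    and r: "0 \<le> r" and \<alpha>: "\<alpha> > 2 * r + DIM('a)"
    and int: "integrable lborel (\<lambda>x. p x * (1 + norm x) powr \<alpha>)"
  shows "integrable lborel (\<lambda>x. sqrt (LINT t|lborel. p t * p (t - x)) * (1 + norm x) powr r)"
proof -
  define A where "A x = (LINT t|lborel. p t * p (t - x))" for x
  define q where "q x = p x * (1 + norm x) powr \<alpha>" for x
  have [measurable]: "A \<in> borel_measurable borel"
    unfolding A_def by measurable
  have [measurable]: "q \<in> borel_measurable borel"
    unfolding q_def by measurable
  have A0: "0 \<le> A x" for x
    unfolding A_def by (intro integral_nonneg_AE AE_I2) (simp add: p0)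
  have q0: "0 \<le> q x" for x
    by (simp add: q_def p0)
  have \<alpha>0: "\<alpha> \<ge> 0"
    using \<alpha> r by linarith
  have pos: "1 + norm x > 0" for x :: 'a
    by (simp add: add_pos_nonneg)
  have le: "p t * p (t - x) * (1 + norm x) powr \<alpha> \<le> q t * q (t - x)" for t x
  proof -
    have "norm x \<le> norm t + norm (t - x)"
      using norm_triangle_ineq4[of t "t - x"] by simp
    moreover have "0 \<le> norm t * norm (t - x)"
      by simp
    ultimately have "1 + norm x \<le> (1 + norm t) * (1 + norm (t - x))"
      unfolding distrib_left distrib_right by linarith
    then have "(1 + norm x) powr \<alpha> \<le> ((1 + norm t) * (1 + norm (t - x))) powr \<alpha>"
      using \<alpha>0 pos[of x] by (intro powr_mono2) auto
    also have "\<dots> = (1 + norm t) powr \<alpha> * (1 + norm (t - x)) powr \<alpha>"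
      by (simp add: powr_mult)
    finally have "p t * p (t - x) * (1 + norm x) powr \<alpha> \<le>
        p t * p (t - x) * ((1 + norm t) powr \<alpha> * (1 + norm (t - x)) powr \<alpha>)"
      by (intro mult_left_mono) (auto simp: p0)
    then show ?thesis
      by (simp add: q_def mult_ac)
  qed
  have "(\<integral>\<^sup>+x. ennreal (A x * (1 + norm x) powr \<alpha>) \<partial>lborel)
      \<le> (\<integral>\<^sup>+x. \<integral>\<^sup>+t. ennreal (q t) * ennreal (q (t - x)) \<partial>lborel \<partial>lborel)"
  proof (rule nn_integral_mono)
    fix x
    have "ennreal (A x * (1 + norm x) powr \<alpha>)
        = ennreal (norm (LINT t|lborel. p t * p (t - x) * (1 + norm x) powr \<alpha>))"
      using A0[of x] by (simp add: A_def)
    \<comment> \<open>This covers points \<open>x\<close> where the product is not integrable in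
      \<open>t\<close> and \<open>A x\<close> is 0 by default.\<close>
    also have "\<dots> \<le> (\<integral>\<^sup>+t. norm (p t * p (t - x) * (1 + norm x) powr \<alpha>) \<partial>lborel)"
      by (rule ennreal_norm_integral_le)
    also have "\<dots> \<le> (\<integral>\<^sup>+t. ennreal (q t) * ennreal (q (t - x)) \<partial>lborel)"
      using le p0 q0 by (intro nn_integral_mono) (simp add: abs_mult ennreal_leI flip: ennreal_mult)
    finally show "ennreal (A x * (1 + norm x) powr \<alpha>) \<le> (\<integral>\<^sup>+t. ennreal (q t) * ennreal (q (t - x)) \<partial>lborel)" .
  qed
  also have "\<dots> = (\<integral>\<^sup>+t. \<integral>\<^sup>+x. ennreal (q t) * ennreal (q (t - x)) \<partial>lborel \<partial>lborel)"
    by (rule lborel_pair.Fubini') measurable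
  also have "\<dots> = (\<integral>\<^sup>+t. ennreal (q t) * (\<integral>\<^sup>+x. ennreal (q x) \<partial>lborel) \<partial>lborel)"
    using nn_integral_lborel_reflect[of "\<lambda>x. ennreal (q x)"] by (simp add: nn_integral_cmult)
  also have "\<dots> = (\<integral>\<^sup>+x. ennreal (q x) \<partial>lborel) * (\<integral>\<^sup>+x. ennreal (q x) \<partial>lborel)"
    by (simp add: nn_integral_multc)
  also have "(\<integral>\<^sup>+x. ennreal (q x) \<partial>lborel) = ennreal (LINT x|lborel. q x)"
    using int q0 by (intro nn_integral_eq_integral) (auto simp: q_def)
  also have "ennreal (LINT x|lborel. q x) * ennreal (LINT x|lborel. q x) < \<infinity>"
    by (simp add: ennreal_mult_less_top)
  finally have "integrable lborel (\<lambda>x. A x * (1 + norm x) powr \<alpha>)"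
    using A0 by (simp add: integrable_iff_bounded)
  moreover have "integrable lborel (\<lambda>x::'a. (1 + norm x) powr - (\<alpha> - 2 * r))"
    using \<alpha> by (intro integrable_one_plus_norm_powr) simp
  ultimately have "integrable lborel (\<lambda>x. A x * (1 + norm x) powr \<alpha> + (1 + norm x) powr - (\<alpha> - 2 * r))"
    by (rule Bochner_Integration.integrable_add)
  then show ?thesis
    unfolding A_def[symmetric]
  proof (rule Bochner_Integration.integrable_bound)
    have "sqrt (A x) * (1 + norm x) powr r \<le> A x * (1 + norm x) powr \<alpha> + (1 + norm x) powr - (\<alpha> - 2 * r)" for x
    proof -
      \<comment> \<open>The exponents add up to \<open>r\<close>. They are chosen so that the square
        of \<open>?u\<close> carries the full power \<alpha> and the square of \<open>?v\<close> the
        power \<open>2 * r - \<alpha>\<close>, which lies below minus the dimension.\<close>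
      let ?u = "sqrt (A x) * (1 + norm x) powr (\<alpha> / 2)" and ?v = "(1 + norm x) powr (r - \<alpha> / 2)"
      have "sqrt (A x) * (1 + norm x) powr r = ?u * ?v"
        using pos[of x] by (simp add: powr_add[symmetric])
      also have "\<dots> \<le> ?u\<^sup>2 + ?v\<^sup>2"
      proof -
        have "0 \<le> ?u * ?v"
          using A0[of x] by (intro mult_nonneg_nonneg) auto
        then show ?thesis
          using sum_squares_bound[of ?u ?v] by linarith
      qed
      also have "?u\<^sup>2 = A x * (1 + norm x) powr \<alpha>"
        using pos[of x] A0[of x] by (simp add: power_mult_distrib powr_power)
      also have "?v\<^sup>2 = (1 + norm x) powr - (\<alpha> - 2 * r)"
        using pos[of x] by (simp add: powr_power)
      finally show ?thesis .
    qed
    then show "AE x in lborel. norm (sqrt (A x) * (1 + norm x) powr r)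
        \<le> norm (A x * (1 + norm x) powr \<alpha> + (1 + norm x) powr - (\<alpha> - 2 * r))"
      by (intro AE_I2) (simp add: A0 abs_mult)
  qed measurable
qed

section \<open>Time-side and frequency-side bounds for the short-time Fourier transform\<close>

lemma AE_lborel_translate:
  fixes t :: "'a::euclidean_space"
  assumes "AE x in lborel. P x"
  shows "AE x in lborel. P (x - t)"
proof -
  have "AE x in distr lborel borel ((+) (- t)). P x"
    using assms by (simp only: lborel_distr_plus)
  then have "AE x in lborel. P (- t + x)"
    by (rule AE_distrD[rotated]) simp
  then show ?thesis
    by simp
qed

lemma stft_lborel:
  assumes [measurable]: "f \<in> borel_measurable borel" "g \<in> borel_measurable borel"
  shows "stft g f (x, \<omega>) = (LINT t|lborel. f t * cnj (g (t - x)) * cis (- (2 * pi * (t \<bullet> \<omega>))))"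
  unfolding stft_def prod.case by (rule integral_completion) measurable

lemma stft_measurable [measurable]:
  fixes f g :: "'a::euclidean_space \<Rightarrow> complex"
  assumes [measurable]: "f \<in> borel_measurable borel" "g \<in> borel_measurable borel"
  shows "stft g f \<in> borel_measurable (lborel \<Otimes>\<^sub>M lborel)"
proof -
  have "stft g f = (\<lambda>z. LINT t|lborel. f t * cnj (g (t - fst z)) * cis (- (2 * pi * (t \<bullet> snd z))))"
    by (auto simp: fun_eq_iff stft_lborel)
  also have "\<dots> \<in> borel_measurable (lborel \<Otimes>\<^sub>M lborel)"
    by measurable
  finally show ?thesis .
qed

lemma norm_stft_le:
  assumes [measurable]: "f \<in> borel_measurable borel" "g \<in> borel_measurable borel"
  shows "cmod (stft g f (x, \<omega>)) \<le> (LINT t|lborel. cmod (f t) * cmod (g (t - x)))"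
  unfolding stft_lborel[OF assms] by (rule order_trans[OF integral_norm_bound]) (simp add: norm_mult)

text \<open>Replace \<open>g (t - x)\<close> by its inversion integral and exchange the integrals;
  the integral over \<open>t\<close> becomes the transform of \<open>f\<close> at
  \<open>\<eta> + \<omega>\<close>.\<close>

lemma stft_eq_fourier:
  fixes f g :: "'a::euclidean_space \<Rightarrow> complex"
  assumes f: "integrable lborel f" and g: "integrable lborel g" and G: "integrable lborel (fourier_integral g)"
  shows "stft g f (x, \<omega>) = (LINT \<eta>|lborel.
      cnj (fourier_integral g \<eta>) * cis (2 * pi * (x \<bullet> \<eta>)) * fourier_integral f (\<eta> + \<omega>))"
proof -
  have [measurable]: "f \<in> borel_measurable borel" "g \<in> borel_measurable borel"
    using f g by auto
  let ?G = "fourier_integral g"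
  let ?H = "\<lambda>t \<eta>. f t * cis (- (2 * pi * (t \<bullet> \<omega>))) * cnj (?G \<eta> * cis (2 * pi * ((t - x) \<bullet> \<eta>)))"
  \<comment> \<open>For fixed \<open>x\<close> inversion holds for almost every \<open>t\<close>,
    which suffices under the integral over \<open>t\<close>.\<close>
  have inv: "AE t in lborel. g (t - x) = (LINT \<eta>|lborel. ?G \<eta> * cis (2 * pi * ((t - x) \<bullet> \<eta>)))"
    by (rule AE_lborel_translate[OF Fourier_inversion[OF g G]])
  have "stft g f (x, \<omega>) = (LINT t|lborel. f t * cis (- (2 * pi * (t \<bullet> \<omega>))) *
      cnj (LINT \<eta>|lborel. ?G \<eta> * cis (2 * pi * ((t - x) \<bullet> \<eta>))))"
    unfolding stft_lborel[OF \<open>f \<in> borel_measurable borel\<close> \<open>g \<in> borel_measurable borel\<close>]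
  proof (rule integral_cong_AE)
    show "AE t in lborel. f t * cnj (g (t - x)) * cis (- (2 * pi * (t \<bullet> \<omega>))) =
        f t * cis (- (2 * pi * (t \<bullet> \<omega>))) * cnj (LINT \<eta>|lborel. ?G \<eta> * cis (2 * pi * ((t - x) \<bullet> \<eta>)))"
      using inv by eventually_elim (simp only: mult_ac)
  qed measurable
  also have "\<dots> = (LINT t|lborel. LINT \<eta>|lborel. ?H t \<eta>)"
    by (simp only: integral_mult_right_zero Bochner_Integration.integral_cnj)
  also have "\<dots> = (LINT \<eta>|lborel. LINT t|lborel. ?H t \<eta>)"
    by (rule Fubini_lborel_dominated[OF _ integrable_norm[OF f] integrable_norm[OF G]])
       (measurable, simp add: norm_mult)
  also have "\<dots> = (LINT \<eta>|lborel. cnj (?G \<eta>) * cis (2 * pi * (x \<bullet> \<eta>)) * fourier_integral f (\<eta> + \<omega>))"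
  proof (intro Bochner_Integration.integral_cong refl)
    fix \<eta>
    have "(LINT t|lborel. ?H t \<eta>) = (LINT t|lborel. (cnj (?G \<eta>) * cis (2 * pi * (x \<bullet> \<eta>))) *
        (f t * cis (- (2 * pi * (t \<bullet> (\<eta> + \<omega>))))))"
    proof (intro Bochner_Integration.integral_cong refl)
      fix t
      have "cis (- (2 * pi * (t \<bullet> \<omega>))) * cis (- (2 * pi * ((t - x) \<bullet> \<eta>))) =
          cis (2 * pi * (x \<bullet> \<eta>)) * cis (- (2 * pi * (t \<bullet> (\<eta> + \<omega>))))"
        unfolding cis_mult by (rule arg_cong[of _ _ cis]) (simp add: inner_diff_left inner_add_right algebra_simps)
      then show "?H t \<eta> = (cnj (?G \<eta>) * cis (2 * pi * (x \<bullet> \<eta>))) * (f t * cis (- (2 * pi * (t \<bullet> (\<eta> + \<omega>)))))"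
        by (simp add: cis_cnj algebra_simps)
    qed
    then show "(LINT t|lborel. ?H t \<eta>) =
        cnj (?G \<eta>) * cis (2 * pi * (x \<bullet> \<eta>)) * fourier_integral f (\<eta> + \<omega>)"
      by (simp only: integral_mult_right_zero fourier_integral_lborel[OF \<open>f \<in> borel_measurable borel\<close>])
  qed
  finally show ?thesis .
qed

lemma norm_stft_le_fourier:
  fixes f g :: "'a::euclidean_space \<Rightarrow> complex"
  assumes "integrable lborel f" "integrable lborel g" "integrable lborel (fourier_integral g)"
  shows "cmod (stft g f (x, \<omega>)) \<le>
    (LINT \<eta>|lborel. cmod (fourier_integral f \<eta>) * cmod (fourier_integral g (\<eta> - \<omega>)))"
proof -
  have "cmod (stft g f (x, \<omega>)) \<le> (LINT \<eta>|lborel. cmod (fourier_integral f (\<eta> + \<omega>)) * cmod (fourier_integral g \<eta>))"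
    unfolding stft_eq_fourier[OF assms]
    by (rule order_trans[OF integral_norm_bound]) (simp add: norm_mult mult.commute)
  \<comment> \<open>Shifting \<eta> by \<omega> gives the correlation form of the time-side bound,
    so the same integrability lemma serves both variables.\<close>
  also have "\<dots> = (LINT \<eta>|lborel. cmod (fourier_integral f \<eta>) * cmod (fourier_integral g (\<eta> - \<omega>)))"
    using integral_lborel_translate[of
      "\<lambda>\<eta>. cmod (fourier_integral f (\<eta> + \<omega>)) * cmod (fourier_integral g \<eta>)" \<omega>] by simp
  finally show ?thesis .
qed

lemma integrable_of_weighted:
  fixes f :: "'a::euclidean_space \<Rightarrow> complex"
  assumes [measurable]: "f \<in> borel_measurable borel" and c: "0 \<le> c"
    and int: "integrable lborel (\<lambda>x. cmod (f x) * (1 + norm x) powr c)"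
  shows "integrable lborel f"
  using int
proof (rule Bochner_Integration.integrable_bound)
  have "1 \<le> (1 + norm x) powr c" for x :: 'a
    using c by (intro ge_one_powr_ge_zero) auto
  then show "AE x in lborel. norm (f x) \<le> norm (cmod (f x) * (1 + norm x) powr c)"
    by (intro AE_I2) (simp add: mult_le_cancel_left1)
qed measurable

lemma stft_weight_integrable:
  fixes g :: "'a::euclidean_space \<Rightarrow> complex" and r s \<alpha> \<beta> :: real
  assumes g [measurable]: "g \<in> borel_measurable borel"
    and r: "0 \<le> r" and s: "0 \<le> s"
    and \<alpha>: "\<alpha> > 2 * r + DIM('a)" and \<beta>: "\<beta> > 2 * s + DIM('a)"
    and g_int: "integrable lborel (\<lambda>x. cmod (g x) * (1 + norm x) powr \<alpha>)"
    and G_int: "integrable lborel (\<lambda>\<omega>. cmod (fourier_integral g \<omega>) * (1 + norm \<omega>) powr \<beta>)"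
  shows "integrable (lborel \<Otimes>\<^sub>M lborel) (\<lambda>z. cmod (stft g g z) * weight r s z)"
proof -
  have g1: "integrable lborel g"
    using \<alpha> r by (intro integrable_of_weighted[OF _ _ g_int]) auto
  have G1: "integrable lborel (fourier_integral g)"
    using \<beta> s by (intro integrable_of_weighted[OF _ _ G_int]) auto
  define A where "A x = (LINT t|lborel. cmod (g t) * cmod (g (t - x)))" for x
  define B where "B \<omega> = (LINT \<eta>|lborel. cmod (fourier_integral g \<eta>) * cmod (fourier_integral g (\<eta> - \<omega>)))" for \<omega>
  have "integrable lborel (\<lambda>x. sqrt (A x) * (1 + norm x) powr r)"
    unfolding A_def using r \<alpha> g_int
    by (intro sqrt_autocorrelation_weighted_integrable[where \<alpha>=\<alpha>]) auto
  moreover have "integrable lborel (\<lambda>\<omega>. sqrt (B \<omega>) * (1 + norm \<omega>) powr s)"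
    unfolding B_def using s \<beta> G_int
    by (intro sqrt_autocorrelation_weighted_integrable[where \<alpha>=\<beta>]) auto
  ultimately have "integrable (lborel \<Otimes>\<^sub>M lborel)
      (\<lambda>(x, \<omega>). (sqrt (A x) * (1 + norm x) powr r) * (sqrt (B \<omega>) * (1 + norm \<omega>) powr s))"
    by (rule integrable_lborel_prod_mult)
  then show ?thesis
  proof (rule Bochner_Integration.integrable_bound)
    show "(\<lambda>z. cmod (stft g g z) * weight r s z) \<in> borel_measurable (lborel \<Otimes>\<^sub>M lborel)"
      unfolding weight_def by measurable
    \<comment> \<open>The geometric mean of a bound in \<open>x\<close> alone and a bound in
      \<omega> alone.\<close>
    have V: "cmod (stft g g (x, \<omega>)) \<le> sqrt (A x) * sqrt (B \<omega>)" for x \<omega>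
    proof -
      have "(cmod (stft g g (x, \<omega>)))\<^sup>2 \<le> A x * B \<omega>"
        unfolding power2_eq_square A_def B_def
        by (intro mult_mono' norm_stft_le norm_stft_le_fourier g g1 G1) auto
      from real_le_rsqrt[OF this] show ?thesis
        by (simp add: real_sqrt_mult)
    qed
    have "cmod (stft g g (x, \<omega>)) * weight r s (x, \<omega>) \<le>
        (sqrt (A x) * (1 + norm x) powr r) * (sqrt (B \<omega>) * (1 + norm \<omega>) powr s)" for x \<omega>
      using mult_right_mono[OF V, of "weight r s (x, \<omega>)" x \<omega>] by (simp add: weight_def mult_ac)
    from order_trans[OF this abs_ge_self]
    show "AE z in lborel \<Otimes>\<^sub>M lborel. norm (cmod (stft g g z) * weight r s z) \<le>
        norm (case z of (x, \<omega>) \<Rightarrow> (sqrt (A x) * (1 + norm x) powr r) * (sqrt (B \<omega>) * (1 + norm \<omega>) powr s))"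
      by (intro AE_I2) (auto simp: weight_def)
  qed
qed

section \<open>Passage from Lebesgue measurable functions to Borel representatives\<close>

lemma lebesgue_measurable_ex_borel:
  fixes f :: "'a::euclidean_space \<Rightarrow> complex"
  assumes [measurable]: "f \<in> borel_measurable lebesgue"
  obtains f' where "f' \<in> borel_measurable borel" "AE x in lborel. f x = f' x"
proof -
  have "(\<lambda>x. Re (f x)) \<in> borel_measurable lebesgue" "(\<lambda>x. Im (f x)) \<in> borel_measurable lebesgue"
    by measurable
  from this[THEN completion_ex_borel_measurable_real] obtain u v where
    [measurable]: "u \<in> borel_measurable borel" "v \<in> borel_measurable borel"
    and ae: "AE x in lborel. Re (f x) = u x" "AE x in lborel. Im (f x) = v x"
    by auto
  show ?thesis
  proof
    show "(\<lambda>x. Complex (u x) (v x)) \<in> borel_measurable borel"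
      unfolding Complex_eq by measurable
    show "AE x in lborel. f x = Complex (u x) (v x)"
      using ae by eventually_elim (simp add: complex_eq_iff)
  qed
qed

lemma fourier_integral_cong_AE:
  fixes f f' :: "'a::euclidean_space \<Rightarrow> complex"
  assumes [measurable]: "f \<in> borel_measurable lebesgue" "f' \<in> borel_measurable lebesgue"
    and eq: "AE x in lborel. f x = f' x"
  shows "fourier_integral f = fourier_integral f'"
proof
  fix \<omega> :: 'a
  have [measurable]: "(\<lambda>x. cis (- (2 * pi * (x \<bullet> \<omega>)))) \<in> borel_measurable lebesgue"
    by (intro measurable_completion) measurable
  show "fourier_integral f \<omega> = fourier_integral f' \<omega>"
    unfolding fourier_integral_def
  proof (rule integral_cong_AE)
    show "AE x in lebesgue. f x * cis (- (2 * pi * (x \<bullet> \<omega>))) = f' x * cis (- (2 * pi * (x \<bullet> \<omega>)))"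
      using AE_completion[OF eq] by eventually_elim simp
  qed measurable
qed

text \<open>The truncations have identical Fourier integrals, so both functions give the same
  predicate to the choice operator. The chosen transforms therefore agree everywhere.\<close>

lemma fourier_L2_cong_AE:
  fixes f f' :: "'a::euclidean_space \<Rightarrow> complex"
  assumes [measurable]: "f \<in> borel_measurable lebesgue" "f' \<in> borel_measurable lebesgue"
    and eq: "AE x in lborel. f x = f' x"
  shows "fourier_L2 f = fourier_L2 f'"
proof -
  have [measurable]: "(indicator (cball 0 (real n)) :: 'a \<Rightarrow> complex) \<in> borel_measurable lebesgue" for n
    by (intro measurable_completion borel_measurable_indicator) simp
  have "fourier_integral (\<lambda>x. indicator (cball 0 (real n)) x * f x) =
      fourier_integral (\<lambda>x. indicator (cball 0 (real n)) x * f' x)" for n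
  proof (rule fourier_integral_cong_AE)
    show "AE x in lborel. indicator (cball 0 (real n)) x * f x = indicator (cball 0 (real n)) x * f' x"
      using eq by eventually_elim simp
  qed (intro borel_measurable_times; measurable)+
  then have "is_fourier_L2 f = is_fourier_L2 f'"
    by (simp add: is_fourier_L2_def fun_eq_iff)
  then show ?thesis
    by (simp add: fourier_L2_def)
qed

lemma measurable_lebesgue_translate:
  fixes f :: "'a::euclidean_space \<Rightarrow> 'b::topological_space"
  assumes "f \<in> borel_measurable lebesgue"
  shows "(\<lambda>x. f (x - t)) \<in> borel_measurable lebesgue"
proof -
  \<comment> \<open>An affine map with all coordinate factors 1 is a translation. Measurability into
    \<open>lebesgue\<close> is required for composing with a function that is only Lebesgue
    measurable.\<close>
  have "(\<lambda>x. - t + (\<Sum>j\<in>Basis. (1 * (x \<bullet> j)) *\<^sub>R j)) \<in> lebesgue \<rightarrow>\<^sub>M lebesgue"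
    by (rule lebesgue_affine_measurable) simp
  then have "(\<lambda>x. x - t) \<in> lebesgue \<rightarrow>\<^sub>M lebesgue"
    by (simp add: euclidean_representation)
  from measurable_compose[OF this assms] show ?thesis .
qed

text \<open>For each fixed \<open>x\<close> and \<omega> the integrand changes only on a null set of
  \<open>t\<close>, by translation invariance, so the transforms agree at every point.\<close>

lemma stft_cong_AE:
  fixes f f' g g' :: "'a::euclidean_space \<Rightarrow> complex"
  assumes [measurable]: "f \<in> borel_measurable lebesgue" "f' \<in> borel_measurable lebesgue"
    and g: "g \<in> borel_measurable lebesgue" "g' \<in> borel_measurable lebesgue"
    and f_eq: "AE x in lborel. f x = f' x" and g_eq: "AE x in lborel. g x = g' x"
  shows "stft g f = stft g' f'"
proof (intro ext, clarify)
  fix x \<omega> :: 'a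
  have [measurable]: "(\<lambda>t. g (t - x)) \<in> borel_measurable lebesgue" "(\<lambda>t. g' (t - x)) \<in> borel_measurable lebesgue"
    using g by (auto intro: measurable_lebesgue_translate)
  have [measurable]: "(\<lambda>t. cis (- (2 * pi * (t \<bullet> \<omega>)))) \<in> borel_measurable lebesgue"
    by (intro measurable_completion) measurable
  show "stft g f (x, \<omega>) = stft g' f' (x, \<omega>)"
    unfolding stft_def prod.case
  proof (rule integral_cong_AE)
    show "AE t in lebesgue. f t * cnj (g (t - x)) * cis (- (2 * pi * (t \<bullet> \<omega>))) =
        f' t * cnj (g' (t - x)) * cis (- (2 * pi * (t \<bullet> \<omega>)))"
      using AE_completion[OF f_eq] AE_completion[OF AE_lborel_translate[OF g_eq, of x]]
      by eventually_elim simp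
  qed measurable
qed

theorem theorem4p2p10:
  fixes g :: "real ^ 'd \<Rightarrow> complex" and r s \<alpha> \<beta> :: real
  assumes "r \<ge> 0" and "s \<ge> 0"
    and "\<alpha> > 2 * r + real CARD('d)" and "\<beta> > 2 * s + real CARD('d)"
    and "g \<in> L2"
    and "integrable lebesgue (\<lambda>x. cmod (g x) * (1 + norm x) powr \<alpha>)"
    and "integrable lebesgue (\<lambda>\<omega>. cmod (fourier_L2 g \<omega>) * (1 + norm \<omega>) powr \<beta>)"
  shows "g \<in> window_class (weight r s) \<and>
    (\<integral>\<^sup>+\<omega>. (\<integral>\<^sup>+x. ennreal (cmod (stft g g (x, \<omega>)) * (1 + norm x) powr r * (1 + norm \<omega>) powr s)
       \<partial>lebesgue) \<partial>lebesgue) < \<infinity>"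
proof -
  have g_leb: "g \<in> borel_measurable lebesgue"
    using assms(5) by (simp add: L2_def)
  \<comment> \<open>The analytic results concern Borel functions; \<open>h\<close> replaces
    \<open>g\<close> in them, and the hypotheses and the transforms are carried over.\<close>
  then obtain h where [measurable]: "h \<in> borel_measurable borel" and gh: "AE x in lborel. g x = h x"
    by (rule lebesgue_measurable_ex_borel)
  have h_leb: "h \<in> borel_measurable lebesgue"
    by (intro measurable_completion) measurable
  have transfer: "integrable lborel (\<lambda>x. \<phi> (h x) x)"
    if int: "integrable lebesgue (\<lambda>x. \<phi> (g x) x)" and [measurable]: "(\<lambda>x. \<phi> (h x) x) \<in> borel_measurable borel"
    for \<phi> :: "complex \<Rightarrow> real ^ 'd \<Rightarrow> real"
  proof -
    have "integrable lebesgue (\<lambda>x. \<phi> (h x) x)"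
    proof (rule integrable_cong_AE_imp[OF int])
      show "AE x in lebesgue. \<phi> (g x) x = \<phi> (h x) x"
        using AE_completion[OF gh] by eventually_elim simp
    qed (intro measurable_completion, measurable)
    then show ?thesis
      by (simp add: integrable_completion)
  qed
  have h2: "integrable lborel (\<lambda>x. (cmod (h x))\<^sup>2)"
    using assms(5) by (intro transfer) (auto simp: L2_def)
  have h\<alpha>: "integrable lborel (\<lambda>x. cmod (h x) * (1 + norm x) powr \<alpha>)"
    using assms(6) by (rule transfer) measurable
  have h1: "integrable lborel h"
    using assms(1,3) by (intro integrable_of_weighted[OF _ _ h\<alpha>]) auto
  have "AE \<omega> in lebesgue. fourier_L2 g \<omega> = fourier_integral h \<omega>"
    unfolding fourier_L2_cong_AE[OF g_leb h_leb gh] by (rule fourier_L2_eq_fourier_integral[OF h1 h2])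
  then have "AE \<omega> in lebesgue. cmod (fourier_L2 g \<omega>) * (1 + norm \<omega>) powr \<beta> =
      cmod (fourier_integral h \<omega>) * (1 + norm \<omega>) powr \<beta>"
    by eventually_elim simp
  from integrable_cong_AE_imp[OF assms(7) _ this]
  have "integrable lebesgue (\<lambda>\<omega>. cmod (fourier_integral h \<omega>) * (1 + norm \<omega>) powr \<beta>)"
    by (simp add: measurable_completion)
  then have h\<beta>: "integrable lborel (\<lambda>\<omega>. cmod (fourier_integral h \<omega>) * (1 + norm \<omega>) powr \<beta>)"
    by (simp add: integrable_completion)
  have V: "stft g g = stft h h"
    by (rule stft_cong_AE[OF g_leb h_leb g_leb h_leb gh gh])
  let ?P = "lborel \<Otimes>\<^sub>M lborel :: ((real ^ 'd) \<times> (real ^ 'd)) measure"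
  have int: "integrable ?P (\<lambda>z. cmod (stft h h z) * weight r s z)"
    using assms(1-4) by (intro stft_weight_integrable[OF _ _ _ _ _ h\<alpha> h\<beta>]) auto
  have w [measurable]: "weight r s \<in> borel_measurable ?P"
    unfolding weight_def by measurable
  have w0: "0 \<le> weight r s z" for z :: "(real ^ 'd) \<times> (real ^ 'd)"
    by (auto simp: weight_def split: prod.split)
  have m: "(\<lambda>z. stft h h z * of_real (weight r s z)) \<in> borel_measurable ?P"
    by measurable
  \<comment> \<open>The weight is nonnegative, so the bound on the modulus is the norm of the
    complex integrand of \<open>window_class\<close>.\<close>
  have "integrable ?P (\<lambda>z. norm (stft h h z * of_real (weight r s z)))"
    using int by (simp add: norm_mult w0)
  then have "integrable ?P (\<lambda>z. stft h h z * of_real (weight r s z))"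
    by (simp only: integrable_norm_iff[OF m])
  then have "integrable lebesgue (\<lambda>z. stft g g z * of_real (weight r s z))"
    using m unfolding V lborel_prod by (simp add: integrable_completion)
  moreover have "(\<integral>\<^sup>+\<omega>. \<integral>\<^sup>+x. ennreal (cmod (stft g g (x, \<omega>)) * (1 + norm x) powr r * (1 + norm \<omega>) powr s)
       \<partial>lebesgue \<partial>lebesgue) < \<infinity>"
  proof -
    have "(\<integral>\<^sup>+\<omega>. \<integral>\<^sup>+x. ennreal (cmod (stft g g (x, \<omega>)) * (1 + norm x) powr r * (1 + norm \<omega>) powr s)
       \<partial>lebesgue \<partial>lebesgue) = (\<integral>\<^sup>+\<omega>. \<integral>\<^sup>+x. ennreal (cmod (stft h h (x, \<omega>)) * weight r s (x, \<omega>)) \<partial>lborel \<partial>lborel)"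
      \<comment> \<open>Completion leaves nonnegative integrals unchanged, which turns both iterated
        integrals into integrals over \<open>lborel\<close>, ready for Tonelli.\<close>
      by (simp add: V nn_integral_completion weight_def mult.assoc)
    also have "\<dots> = (\<integral>\<^sup>+z. ennreal (cmod (stft h h z) * weight r s z) \<partial>?P)"
      by (rule lborel_pair.nn_integral_snd) measurable
    also have "\<dots> < \<infinity>"
      using int w0 by (simp add: integrable_iff_bounded abs_mult)
    finally show ?thesis .
  qed
  ultimately show ?thesis
    using assms(5) by (simp add: window_class_def)
qed

end
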